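(* Let $p$ be a prime, $k$ a positive integer, and $q=p^k$ with $q\equiv 1\pmod 3$. Let $n$ be a positive integer with $\gcd\big(n,\frac{q-1}{3}\big)=1$. Then the number of elements $a\in\mathbb{F}_q$ for which $x^n\big(x^{\frac{q-1}{3}}+a\big)$ is a permutation polynomial of $\mathbb{F}_q$ equals $$\frac{2q-3(\epsilon_1+\epsilon_2)-10-2\big(\pi_p^{\,k}+\overline{\pi_p}^{\,k}\big)}{9},$$ where $\epsilon_1=-2$ if $q-3n\equiv 1\pmod 9$ and $\epsilon_1=1$ otherwise, and $\epsilon_2=-2$ if $n\equiv 0\pmod 3$ and $\epsilon_2=1$ otherwise.
   Context: A polynomial is a permutation polynomial of $\mathbb{F}_q$ if it induces a bijection of $\mathbb{F}_q$. Note $q\equiv1\pmod 3$ forces $p\neq3$. For a prime $p\neq 3$ define the integer $\kappa_p$ as follows: $\kappa_7=1$, $\kappa_{13}=-5$; if $p\equiv 1\pmod 3$ and $p\ge 19$, $\kappa_p$ is the unique integer with $|\kappa_p|\le 2\sqrt p$ and $\kappa_p\equiv-\binom{\frac{p-1}{2}}{\frac{p-1}{3}}\cdot 4^{-\frac{p-1}{6}}\pmod p$; if $p\equiv 2\pmod 3$ (including $p=2$), $\kappa_p=0$. Define the complex number $\pi_p=\frac{-\kappa_p}{2}+i\sqrt{p-\frac{\kappa_p^2}{4}}$, and $\overline{\pi_p}$ its complex conjugate. *)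

theory Defs
  imports Complex_Main "HOL-Number_Theory.Number_Theory"
begin

definition kappa :: "nat \<Rightarrow> int" where
  "kappa p =
     (if p = 7 then 1
      else if p = 13 then -5
      else if p mod 3 = 1 \<and> p \<ge> 19 then
        (THE k::int. \<bar>real_of_int k\<bar> \<le> 2 * sqrt (real p) \<and>
           [k * 4 ^ ((p - 1) div 6) = - int (((p - 1) div 2) choose ((p - 1) div 3))] (mod int p))
      else 0)"

definition pi_p :: "nat \<Rightarrow> complex" where
  "pi_p p = Complex (- real_of_int (kappa p) / 2)
                    (sqrt (real p - (real_of_int (kappa p))^2 / 4))"

end

theory Submission
  imports Defs "HOL-Computational_Algebra.Polynomial"
begin

text \<open>
  Write \<open>s = (q - 1) / 3\<close>. The binomial permutes the field iff \<open>z \<mapsto> z ^ n * (z + a) ^ s\<close> permutes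
  the cube roots of unity, and three cube roots of unity are distinct iff their product is \<open>1\<close> and
  they are not all equal. Both conditions on \<open>a\<close> are counted by cyclotomic numbers of order three,
  and these are all determined by \<open>A = 2 Re J\<close> for the cubic Jacobi sum \<open>J\<close>.

  Instead of the Hasse-Davenport relation, \<open>A\<close> is identified by arithmetic:
  \<open>|J|\<^sup>2 = q\<close> gives \<open>4 q = A\<^sup>2 + 27 B\<^sup>2\<close> with \<open>A \<equiv> 1 (mod 3)\<close>. If \<open>p \<equiv> 2 (mod 3)\<close>, then \<open>p\<close> is
  inert in the Eisenstein integers and a descent forces \<open>A\<close>. If \<open>p \<equiv> 1 (mod 3)\<close>, then power sums
  give \<open>A \<equiv> - binomial (2 s, s) (mod p)\<close>, which is nonzero by Lucas' theorem; such an \<open>A\<close> is unique,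
  and \<open>- (\<pi>\<^sup>k + cnj \<pi>\<^sup>k)\<close> has the same properties. The same congruence over the prime field,
  where \<open>4 ^ m * binomial (4 m, 2 m) \<equiv> binomial (3 m, 2 m)\<close> modulo \<open>p = 6 m + 1\<close>, identifies \<open>kappa p\<close>.
\<close>

section \<open>Finite subfields\<close>

lemma finite_card_power_eq:
  fixes c :: "'a::field"
  assumes "n > 0"
  shows "finite {x. x ^ n = c}" and "card {x. x ^ n = c} \<le> n"
proof -
  define P where "P = monom 1 n + [:- c:]"
  have deg: "degree P = n"
  proof -
    have "degree (monom 1 n + [:- c:]) = degree (monom (1::'a) n)"
      using assms by (intro degree_add_eq_left) (simp add: degree_monom_eq)
    thus ?thesis by (simp add: P_def degree_monom_eq)
  qed
  hence "P \<noteq> 0" using assms by auto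
  moreover have "{x. poly P x = 0} = {x. x ^ n = c}"
    by (simp add: P_def poly_monom)
  ultimately show "finite {x. x ^ n = c}" "card {x. x ^ n = c} \<le> n"
    using poly_roots_finite[of P] card_poly_roots_bound[of P] deg by auto
qed

text \<open>A fibre below the bound \<open>m\<close> would leave the fibre sizes summing to less
  than \<open>m * card B\<close>. This yields exact fibre sizes of power maps from root counts
  alone, without a generator of the unit group.\<close>

lemma card_fibre_eq:
  fixes f :: "'a \<Rightarrow> 'b"
  assumes "finite A" and "finite B" and "f ` A \<subseteq> B"
    and le: "\<And>b. b \<in> B \<Longrightarrow> card {a \<in> A. f a = b} \<le> m"
    and total: "card A = m * card B" and "b \<in> B"
  shows "card {a \<in> A. f a = b} = m"
proof (rule ccontr)
  assume "card {a \<in> A. f a = b} \<noteq> m"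
  with le[OF \<open>b \<in> B\<close>] have "card {a \<in> A. f a = b} < m" by simp
  hence "(\<Sum>b\<in>B. card {a \<in> A. f a = b}) < (\<Sum>b\<in>B. m)"
    using assms by (intro sum_strict_mono_ex1) auto
  also have "(\<Sum>b\<in>B. card {a \<in> A. f a = b}) = card A"
    using sum.group[OF assms(1-3), of "\<lambda>_. 1::nat"] by simp
  finally show False using total by simp
qed

text \<open>Fields are modelled as subsets of an ambient type, so that the prime field of \<open>'a\<close> can be
  treated alongside \<open>UNIV\<close>. By finiteness, closure under inverses is automatic.\<close>

locale finite_subfield =
  fixes K :: "'a::field set"
  assumes finite_K: "finite K"
    and one_mem: "1 \<in> K"
    and diff_mem: "\<lbrakk>x \<in> K; y \<in> K\<rbrakk> \<Longrightarrow> x - y \<in> K"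
    and mult_mem: "\<lbrakk>x \<in> K; y \<in> K\<rbrakk> \<Longrightarrow> x * y \<in> K"
begin

lemma zero_mem: "0 \<in> K"
  using diff_mem[OF one_mem one_mem] by simp

lemma uminus_mem: "x \<in> K \<Longrightarrow> - x \<in> K"
  using diff_mem[OF zero_mem] by force

lemma add_mem: "\<lbrakk>x \<in> K; y \<in> K\<rbrakk> \<Longrightarrow> x + y \<in> K"
  using diff_mem[OF _ uminus_mem, of x y] by simp

lemma power_mem: "x \<in> K \<Longrightarrow> x ^ n \<in> K"
  by (induction n) (auto intro: one_mem mult_mem)

lemma mult_image_eq:
  assumes "x \<in> K" "x \<noteq> 0"
  shows "(*) x ` (K - {0}) = K - {0}"
proof (rule endo_inj_surj)
  show "finite (K - {0})" using finite_K by simp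
  show "(*) x ` (K - {0}) \<subseteq> K - {0}" using assms by (auto intro: mult_mem)
  show "inj_on ((*) x) (K - {0})" using assms by (auto intro: inj_onI)
qed

lemma inverse_mem:
  assumes "x \<in> K"
  shows "inverse x \<in> K"
proof (cases "x = 0")
  case False
  have "1 \<in> (*) x ` (K - {0})"
    using mult_image_eq[OF assms False] one_mem by simp
  then obtain y where "y \<in> K" "x * y = 1" by (metis DiffD1 imageE)
  thus ?thesis using inverse_unique by metis
qed (use zero_mem in simp)

lemma divide_mem: "\<lbrakk>x \<in> K; y \<in> K\<rbrakk> \<Longrightarrow> x / y \<in> K"
  by (simp add: divide_inverse mult_mem inverse_mem)

lemmas K_mem = zero_mem one_mem diff_mem mult_mem uminus_mem add_mem power_mem
  inverse_mem divide_mem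

lemma card_ge_2: "card K \<ge> 2"
  using card_mono[OF finite_K, of "{0, 1}"] zero_mem one_mem by simp

lemma card_units: "card (K - {0}) = card K - 1"
  using finite_K zero_mem by simp

section \<open>Fermat's little theorem and power sums over \<open>K\<close>\<close>

lemma power_card_minus_1:
  assumes "x \<in> K" "x \<noteq> 0"
  shows "x ^ (card K - 1) = 1"
proof -
  have "\<Prod>(K - {0}) = \<Prod>((*) x ` (K - {0}))"
    by (simp add: mult_image_eq[OF assms])
  also have "\<dots> = (\<Prod>y\<in>K - {0}. x * y)"
    using assms by (subst prod.reindex) (auto intro: inj_onI)
  also have "\<dots> = x ^ (card K - 1) * \<Prod>(K - {0})"
    by (simp add: prod.distrib card_units)
  finally show ?thesis using finite_K by simp
qed

lemma of_nat_card_eq_0: "of_nat (card K) = (0::'a)"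
proof -
  have "(\<Sum>x\<in>K. x + 1) = (\<Sum>x\<in>K. x)"
    by (rule sum.reindex_bij_witness[of _ "\<lambda>x. x - 1" "\<lambda>x. x + 1"]) (auto intro: K_mem)
  thus ?thesis by (simp add: sum.distrib)
qed

text \<open>The polynomial \<open>y ^ j - 1\<close> has at most \<open>j\<close> roots, fewer than
  there are units.\<close>

lemma ex_power_neq_1:
  assumes "0 < j" "j < card K - 1"
  obtains y where "y \<in> K" "y \<noteq> 0" "y ^ j \<noteq> 1"
proof -
  have "\<not> K - {0} \<subseteq> {y. y ^ j = 1}"
  proof
    assume "K - {0} \<subseteq> {y. y ^ j = 1}"
    hence "card (K - {0}) \<le> card {y::'a. y ^ j = 1}"
      by (intro card_mono finite_card_power_eq assms)
    also have "\<dots> \<le> j" by (intro finite_card_power_eq assms)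
    finally show False using assms card_units by simp
  qed
  thus ?thesis using that by auto
qed

lemma sum_power_eq_0:
  assumes "j < card K - 1"
  shows "(\<Sum>x\<in>K. x ^ j) = 0"
proof (cases "j = 0")
  case True
  \<comment> \<open>Since \<open>0 ^ 0 = 1\<close>, the sum is \<open>card K\<close>, the term at 0
    included.\<close>
  thus ?thesis by (simp add: of_nat_card_eq_0)
next
  case False
  then obtain y where y: "y \<in> K" "y \<noteq> 0" "y ^ j \<noteq> 1"
    using ex_power_neq_1 assms by blast
  have "(\<Sum>x\<in>K. x ^ j) = (\<Sum>x\<in>K. (y * x) ^ j)"
    by (rule sum.reindex_bij_witness[of _ "\<lambda>x. y * x" "\<lambda>x. x / y"]) (use y in \<open>auto intro: K_mem\<close>)
  also have "\<dots> = y ^ j * (\<Sum>x\<in>K. x ^ j)"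
    by (simp add: power_mult_distrib sum_distrib_left)
  finally show ?thesis using y by simp
qed

text \<open>Positivity of \<open>j\<close> matters at \<open>x = 0\<close>: for \<open>j = 0\<close>
  the left term there is 0 and the right one \<open>0 ^ 0 = 1\<close>.\<close>

lemma sum_power_add_period:
  assumes "0 < j"
  shows "(\<Sum>x\<in>K. x ^ (card K - 1 + j)) = (\<Sum>x\<in>K. x ^ j)"
proof (rule sum.cong)
  fix x assume "x \<in> K"
  thus "x ^ (card K - 1 + j) = x ^ j"
    using power_card_minus_1[of x] assms by (cases "x = 0") (auto simp: power_add)
qed simp

lemma sum_power_card_minus_1: "(\<Sum>x\<in>K. x ^ (card K - 1)) = - 1"
proof -
  have "(\<Sum>x\<in>K. x ^ (card K - 1)) = (\<Sum>x\<in>K - {0}. 1)"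
    by (rule sum.mono_neutral_cong_right)
      (use finite_K card_ge_2 power_card_minus_1 in \<open>auto simp: power_0_left\<close>)
  also have "\<dots> = of_nat (card K) - 1"
    using card_units card_ge_2 by (simp add: of_nat_diff)
  finally show ?thesis by (simp add: of_nat_card_eq_0)
qed

text \<open>Every unit \<open>y\<close> gives a cube root of unity \<open>y ^ s\<close>, and too few
  units have \<open>y ^ s = 1\<close> for all of these to be trivial.\<close>

lemma ex_primitive_cube_root:
  assumes "card K mod 3 = 1"
  obtains w where "w \<in> K" "w ^ 2 + w + 1 = 0" "w \<noteq> 1"
proof -
  define s where "s = (card K - 1) div 3"
  have s: "card K - 1 = s * 3" using assms unfolding s_def by presburger
  obtain y where y: "y \<in> K" "y \<noteq> 0" "y ^ s \<noteq> 1"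
  proof (rule ex_power_neq_1)
    show "0 < s" "s < card K - 1" using s card_ge_2 by auto
  qed
  have "(y ^ s) ^ 3 = 1"
    using power_card_minus_1[of y] y s by (simp add: power_mult)
  hence "(y ^ s - 1) * ((y ^ s) ^ 2 + y ^ s + 1) = 0"
    by (simp add: algebra_simps power2_eq_square power3_eq_cube)
  thus ?thesis using that[of "y ^ s"] y by (simp add: power_mem)
qed

end

section \<open>Cyclotomic numbers of order three\<close>

locale cubic_subfield = finite_subfield K for K :: "'a::field set" +
  fixes w :: 'a
  assumes card_mod_3: "card K mod 3 = 1"
    and w_mem: "w \<in> K"
    and w_eq: "w ^ 2 + w + 1 = 0"
    and w_neq_1: "w \<noteq> 1"
begin

definition s :: nat where "s = (card K - 1) div 3"

lemma card_K: "card K = 3 * s + 1"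
  using card_mod_3 unfolding s_def by presburger

lemma s_pos: "s > 0"
  using card_K card_ge_2 by (cases s) auto

section \<open>Cube roots of unity and cubic residue classes\<close>

lemma w_cubed: "w ^ 3 = 1"
proof -
  have "w ^ 3 - 1 = (w - 1) * (w ^ 2 + w + 1)"
    by (simp add: algebra_simps power2_eq_square power3_eq_cube)
  thus ?thesis by (simp add: w_eq)
qed

lemma w_neq_0: "w \<noteq> 0"
  using w_cubed by auto

lemma w_sq_neq_w: "w ^ 2 \<noteq> w"
  using w_neq_0 w_neq_1 by (auto simp: power2_eq_square)

lemma w_sq_neq_1: "w ^ 2 \<noteq> 1"
  using w_cubed w_neq_1 by (auto simp: power2_eq_square power3_eq_cube)

lemma w_distinct [simp]:
  "w \<noteq> 0" "w \<noteq> 1" "1 \<noteq> w" "w ^ 2 \<noteq> 1" "1 \<noteq> w ^ 2" "w ^ 2 \<noteq> w" "w \<noteq> w ^ 2"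
  using w_neq_0 w_neq_1 w_sq_neq_1 w_sq_neq_w by auto

lemma w_mult [simp]:
  "w * w = w ^ 2" "w * w ^ 2 = 1" "w ^ 2 * w = 1" "w ^ 2 * w ^ 2 = w"
  "1 / w = w ^ 2" "1 / w ^ 2 = w" "(w ^ 2) ^ 2 = w" "w ^ 4 = w"
proof -
  show 1: "w * w = w ^ 2" "w * w ^ 2 = 1" "w ^ 2 * w = 1"
    using w_cubed by (simp_all add: power2_eq_square power3_eq_cube mult.assoc)
  show 2: "w ^ 2 * w ^ 2 = w"
    using 1 by (metis mult.assoc mult.right_neutral power2_eq_square)
  show "1 / w = w ^ 2" "1 / w ^ 2 = w" "(w ^ 2) ^ 2 = w" "w ^ 4 = w"
    using 1 2 by (simp_all add: divide_eq_eq power2_eq_square power4_eq_xxxx mult.assoc)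
qed

definition mu3 :: "'a set" where "mu3 = {1, w, w ^ 2}"

lemma mu3_iff: "x \<in> mu3 \<longleftrightarrow> x ^ 3 = 1"
proof -
  have "x ^ 3 - 1 - (x - 1) * (x - w) * (x - w ^ 2) =
    (w ^ 2 + w + 1) * x ^ 2 - w * (w ^ 2 + w + 1) * x + w ^ 3 - 1"
    by (simp add: algebra_simps power2_eq_square power3_eq_cube del: w_mult)
  also have "\<dots> = 0" by (simp add: w_eq w_cubed)
  finally have "x ^ 3 = 1 \<longleftrightarrow> (x - 1) * (x - w) * (x - w ^ 2) = 0"
    by (metis eq_iff_diff_eq_0 diff_0_right diff_zero)
  thus ?thesis by (auto simp: mu3_def)
qed

lemma finite_mu3: "finite mu3" and card_mu3: "card mu3 = 3"
  by (simp_all add: mu3_def)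

lemma power_s_mem_mu3:
  assumes "x \<in> K" "x \<noteq> 0"
  shows "x ^ s \<in> mu3"
  using power_card_minus_1[OF assms] card_K
  by (simp add: mu3_iff flip: power_mult) (simp add: mult.commute)

lemma one_minus_power_s_mem_mu3: "\<lbrakk>x \<in> K; x \<noteq> 1\<rbrakk> \<Longrightarrow> (1 - x) ^ s \<in> mu3"
  by (rule power_s_mem_mu3) (auto intro: K_mem)

text \<open>\<open>- 1\<close> is its own cube, so its cubic class is trivial; signs can therefore
  be ignored below.\<close>

lemma minus_one_power_s: "(- 1) ^ s = (1::'a)"
proof -
  have "((- 1) ^ 3) ^ s = (- 1 :: 'a) ^ (3 * s)" by (rule power_mult[symmetric])
  also have "\<dots> = 1"
    using power_card_minus_1[of "- 1"] card_K by (simp add: K_mem)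
  finally show ?thesis by simp
qed

lemma uminus_power_s: "(- x) ^ s = (x::'a) ^ s"
  using minus_one_power_s by (subst power_minus) simp

text \<open>Three fibres of at most \<open>s\<close> elements each have to exhaust
  \<open>3 * s\<close> units.\<close>

lemma card_power_s_fibre:
  assumes "c \<in> mu3"
  shows "card {x \<in> K - {0}. x ^ s = c} = s"
proof (rule card_fibre_eq[OF _ finite_mu3 _ _ _ assms])
  fix b
  have "card {x \<in> K - {0}. x ^ s = b} \<le> card {x. x ^ s = b}"
    by (intro card_mono finite_card_power_eq s_pos) auto
  also have "\<dots> \<le> s" by (intro finite_card_power_eq s_pos)
  finally show "card {x \<in> K - {0}. x ^ s = b} \<le> s" .
qed (use finite_K power_s_mem_mu3 card_K card_units card_mu3 in auto)

lemma ex_power_s_eq: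
  assumes "c \<in> mu3"
  obtains x where "x \<in> K" "x \<noteq> 0" "x ^ s = c"
proof -
  have "{x \<in> K - {0}. x ^ s = c} \<noteq> {}"
    using s_pos card_power_s_fibre[OF assms] by (metis card.empty less_numeral_extra(3))
  thus ?thesis using that by blast
qed

text \<open>Cubing maps the \<open>3 * s\<close> units into the \<open>s\<close> units of trivial
  class with at most three preimages each, so every one of them is hit exactly three times.\<close>

lemma card_cube_fibre:
  assumes "c \<in> K" "c ^ s = 1"
  shows "card {x \<in> K - {0}. x ^ 3 = c} = 3"
proof -
  define B where "B = {x \<in> K - {0}. x ^ s = 1}"
  have "card B = s" unfolding B_def
    by (rule card_power_s_fibre) (simp add: mu3_def)
  moreover have "(\<lambda>x. x ^ 3) ` (K - {0}) \<subseteq> B"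
  proof
    fix y assume "y \<in> (\<lambda>x. x ^ 3) ` (K - {0})"
    then obtain x where x: "x \<in> K" "x \<noteq> 0" "y = x ^ 3" by auto
    hence "y ^ s = 1"
      using power_card_minus_1[of x] card_K by (simp flip: power_mult)
    thus "y \<in> B" using x by (auto simp: B_def K_mem)
  qed
  moreover have "c \<in> B"
    using assms s_pos by (auto simp: B_def power_0_left)
  moreover have "card {x \<in> K - {0}. x ^ 3 = b} \<le> 3" for b
  proof -
    have "card {x \<in> K - {0}. x ^ 3 = b} \<le> card {x. x ^ 3 = b}"
      by (intro card_mono finite_card_power_eq) auto
    also have "\<dots> \<le> 3" by (rule finite_card_power_eq) simp
    finally show ?thesis .
  qed
  moreover have "card (K - {0}) = 3 * card B"
    using calculation card_units card_K by simp
  ultimately show ?thesis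
    using finite_K by (intro card_fibre_eq[of _ B]) (auto simp: B_def)
qed

text \<open>\<open>x ^ s\<close> names the cubic class of a unit \<open>x\<close>. The sizes of
  these sets are the cyclotomic numbers of order three; using \<open>1 - r\<close> instead of
  \<open>1 + r\<close> changes nothing because \<open>- 1\<close> is a cube.\<close>

definition cyc :: "'a \<Rightarrow> 'a \<Rightarrow> 'a set" where
  "cyc c d = {r \<in> K - {0, 1}. r ^ s = c \<and> (1 - r) ^ s = d}"

lemma finite_cyc: "finite (cyc c d)"
  using finite_K by (simp add: cyc_def)

lemma cyc_disjoint: "d \<noteq> d' \<Longrightarrow> cyc c d \<inter> cyc c d' = {}"
  by (auto simp: cyc_def)

lemma card_cyc_swap: "card (cyc c d) = card (cyc d c)"
  by (rule bij_betw_same_card[of "\<lambda>r. 1 - r"],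
      rule bij_betw_byWitness[where f' = "\<lambda>r. 1 - r"])
     (auto simp: cyc_def intro: K_mem)

text \<open>Inversion turns \<open>1 - r\<close> into \<open>- (1 - r) / r\<close>, and the sign
  does not affect the class. Applied twice, the inequality becomes the equality that
  follows.\<close>

lemma card_cyc_inverse_le:
  "card (cyc c d) \<le> card (cyc (1 / c) (d / c))"
proof (rule card_inj_on_le[of inverse])
  show "inj_on inverse (cyc c d)" by (auto intro: inj_onI)
  show "inverse ` cyc c d \<subseteq> cyc (1 / c) (d / c)"
  proof
    fix y assume "y \<in> inverse ` cyc c d"
    then obtain r where r: "r \<in> K" "r \<noteq> 0" "r \<noteq> 1" "r ^ s = c" "(1 - r) ^ s = d" "y = inverse r"
      by (auto simp: cyc_def)
    have "1 - y = - ((1 - r) / r)" using r by (simp add: field_simps)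
    hence "(1 - y) ^ s = d / c" using r by (simp only: uminus_power_s power_divide)
    thus "y \<in> cyc (1 / c) (d / c)"
      using r by (auto simp: cyc_def K_mem power_inverse inverse_eq_divide power_divide)
  qed
qed (rule finite_cyc)

lemma card_cyc_inverse:
  assumes "c \<noteq> 0"
  shows "card (cyc (1 / c) (d / c)) = card (cyc c d)"
proof (rule antisym)
  have "card (cyc (1 / c) (d / c)) \<le> card (cyc (1 / (1 / c)) ((d / c) / (1 / c)))"
    by (rule card_cyc_inverse_le)
  thus "card (cyc (1 / c) (d / c)) \<le> card (cyc c d)" using assms by simp
qed (rule card_cyc_inverse_le)

text \<open>Swapping and inverting leave four orbits of pairs of classes, represented by
  \<open>(1, 1)\<close>, \<open>(1, w)\<close>, \<open>(1, w ^ 2)\<close> and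
  \<open>(w, w ^ 2)\<close>; a row count expresses the fourth by \<open>d0\<close>.\<close>

definition d0 :: nat where "d0 = card (cyc 1 1)"
definition d1 :: nat where "d1 = card (cyc 1 w)"
definition d2 :: nat where "d2 = card (cyc 1 (w ^ 2))"

lemma card_cyc_d1: "card (cyc 1 w) = d1" "card (cyc w 1) = d1" "card (cyc (w ^ 2) (w ^ 2)) = d1"
  using card_cyc_swap[of w 1] card_cyc_inverse[of w 1] by (simp_all add: d1_def)

lemma card_cyc_d2: "card (cyc 1 (w ^ 2)) = d2" "card (cyc (w ^ 2) 1) = d2" "card (cyc w w) = d2"
  using card_cyc_swap[of "w ^ 2" 1] card_cyc_inverse[of "w ^ 2" 1] by (simp_all add: d2_def)

lemma card_cyc_row:
  assumes "c \<in> mu3"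
  shows "card {x \<in> K - {0, 1}. x ^ s = c} = card (cyc c 1) + card (cyc c w) + card (cyc c (w ^ 2))"
proof -
  have "{x \<in> K - {0, 1}. x ^ s = c} = (cyc c 1 \<union> cyc c w) \<union> cyc c (w ^ 2)"
    using one_minus_power_s_mem_mu3 by (auto simp: cyc_def mu3_def)
  moreover have "card ((cyc c 1 \<union> cyc c w) \<union> cyc c (w ^ 2)) = card (cyc c 1 \<union> cyc c w) + card (cyc c (w ^ 2))"
    by (rule card_Un_disjoint) (simp_all add: finite_cyc Int_Un_distrib2 cyc_disjoint)
  moreover have "card (cyc c 1 \<union> cyc c w) = card (cyc c 1) + card (cyc c w)"
    by (rule card_Un_disjoint) (simp_all add: finite_cyc Int_Un_distrib2 cyc_disjoint)
  ultimately show ?thesis by simp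
qed

lemma s_eq_row_1: "s = d0 + d1 + d2 + 1"
proof -
  have "{x \<in> K - {0}. x ^ s = 1} = insert 1 {x \<in> K - {0, 1}. x ^ s = 1}"
    using one_mem by auto
  hence "s = Suc (card {x \<in> K - {0, 1}. x ^ s = 1})"
    using card_power_s_fibre[of 1] finite_K by (simp add: mu3_def)
  thus ?thesis
    using card_cyc_row[of 1] by (simp add: mu3_def d0_def d1_def d2_def)
qed

text \<open>Both classes have \<open>s\<close> elements, but the class of 1 contains the excluded
  point \<open>r = 1\<close>, so the row of \<open>w\<close> has one more element to
  distribute.\<close>

lemma card_cyc_d0:
  "card (cyc w (w ^ 2)) = d0 + 1" "card (cyc (w ^ 2) w) = d0 + 1"
proof -
  have "{x \<in> K - {0}. x ^ s = w} = {x \<in> K - {0, 1}. x ^ s = w}"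
    by auto
  hence "s = card {x \<in> K - {0, 1}. x ^ s = w}"
    using card_power_s_fibre[of w] finite_K by (simp add: mu3_def)
  also have "\<dots> = d1 + d2 + card (cyc w (w ^ 2))"
    using card_cyc_row[of w] by (simp add: mu3_def card_cyc_d1 card_cyc_d2)
  finally show "card (cyc w (w ^ 2)) = d0 + 1" using s_eq_row_1 by simp
  thus "card (cyc (w ^ 2) w) = d0 + 1" using card_cyc_swap by metis
qed

text \<open>Serves two purposes: with values in \<open>K\<close> it gives the trace modulo the
  characteristic, with complex values the Jacobi sum.\<close>

lemma sum_cyc:
  fixes h :: "'a \<Rightarrow> 'a \<Rightarrow> 'b::comm_semiring_1"
  shows "(\<Sum>r\<in>K - {0, 1}. h (r ^ s) ((1 - r) ^ s)) =
    of_nat d0 * h 1 1 + of_nat d1 * (h 1 w + h w 1 + h (w ^ 2) (w ^ 2))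
    + of_nat d2 * (h 1 (w ^ 2) + h (w ^ 2) 1 + h w w)
    + of_nat (d0 + 1) * (h w (w ^ 2) + h (w ^ 2) w)"
proof -
  let ?g = "\<lambda>r. (r ^ s, (1 - r) ^ s)"
  let ?F = "\<lambda>p. (\<Sum>r | r \<in> K - {0, 1} \<and> ?g r = p. h (r ^ s) ((1 - r) ^ s))"
  have F: "?F (c, d) = of_nat (card (cyc c d)) * h c d" for c d
  proof -
    have "?F (c, d) = (\<Sum>r\<in>cyc c d. h c d)"
      by (rule sum.cong) (auto simp: cyc_def)
    thus ?thesis by simp
  qed
  have "(\<Sum>r\<in>K - {0, 1}. h (r ^ s) ((1 - r) ^ s)) = sum ?F (mu3 \<times> mu3)"
    using finite_K finite_mu3 power_s_mem_mu3 one_minus_power_s_mem_mu3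
    by (intro sum.group[symmetric]) (auto simp: K_mem)
  also have "\<dots> = (\<Sum>c\<in>mu3. \<Sum>d\<in>mu3. ?F (c, d))"
    unfolding sum.cartesian_product by (rule sum.cong) auto
  also have "\<dots> = (\<Sum>c\<in>mu3. \<Sum>d\<in>mu3. of_nat (card (cyc c d)) * h c d)"
    by (simp only: F)
  also have "\<dots> = of_nat d0 * h 1 1 + of_nat d1 * (h 1 w + h w 1 + h (w ^ 2) (w ^ 2))
    + of_nat d2 * (h 1 (w ^ 2) + h (w ^ 2) 1 + h w w)
    + of_nat (d0 + 1) * (h w (w ^ 2) + h (w ^ 2) w)"
    unfolding mu3_def
    by (simp add: card_cyc_d0 card_cyc_d1 card_cyc_d2 d0_def[symmetric] algebra_simps
        del: of_nat_add of_nat_Suc)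
  finally show ?thesis .
qed

text \<open>Twice the real part of the cubic Jacobi sum of \<open>K\<close>, that is, minus the trace of Frobenius of
  the Fermat cubic.\<close>

definition trace :: int where "trace = 9 * int d0 + 8 - int (card K)"

lemma trace_mod_3: "trace mod 3 = 1"
  using card_K by (simp add: trace_def) presburger

section \<open>The trace modulo the characteristic\<close>

lemma sum_power_mult_power_eq:
  "(\<Sum>x\<in>K. x ^ a * (1 - x) ^ b) =
    (\<Sum>i\<le>b. of_nat (b choose i) * (- 1) ^ i * (\<Sum>x\<in>K. x ^ (a + i)))"
proof -
  have "x ^ a * (1 - x) ^ b = (\<Sum>i\<le>b. of_nat (b choose i) * (- 1) ^ i * x ^ (a + i))" for x :: 'a
  proof -
    have "(1 - x) ^ b = (- x + 1) ^ b" by simp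
    also have "\<dots> = (\<Sum>i\<le>b. of_nat (b choose i) * (- x) ^ i)"
      by (simp only: binomial_ring power_one mult_1_right)
    finally show ?thesis
      by (simp add: sum_distrib_left power_add power_minus[of x] mult_ac)
  qed
  hence "(\<Sum>x\<in>K. x ^ a * (1 - x) ^ b) =
    (\<Sum>x\<in>K. \<Sum>i\<le>b. of_nat (b choose i) * (- 1) ^ i * x ^ (a + i))" by simp
  also have "\<dots> = (\<Sum>i\<le>b. \<Sum>x\<in>K. of_nat (b choose i) * (- 1) ^ i * x ^ (a + i))"
    by (rule sum.swap)
  finally show ?thesis by (simp add: sum_distrib_left)
qed

text \<open>All exponents \<open>s + i\<close> are at most \<open>2 * s < card K - 1\<close>, so
  each power sum vanishes.\<close>

lemma sum_power_s_mult: "(\<Sum>x\<in>K. x ^ s * (1 - x) ^ s) = 0"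
  unfolding sum_power_mult_power_eq
  using card_K s_pos by (intro sum.neutral) (auto simp: sum_power_eq_0)

text \<open>The exponents run from \<open>2 * s\<close> to \<open>4 * s\<close>; the only multiple
  of \<open>card K - 1 = 3 * s\<close> among them occurs at \<open>i = s\<close>.\<close>

lemma sum_power_2s_mult:
  "(\<Sum>x\<in>K. x ^ (2 * s) * (1 - x) ^ (2 * s)) = - of_nat ((2 * s) choose s)"
proof -
  have "(\<Sum>x\<in>K. x ^ (2 * s + i)) = (if i = s then - 1 else 0)" if "i \<le> 2 * s" for i
  proof -
    consider "i < s" | "i = s" | "i > s" by linarith
    thus ?thesis
    proof cases
      case 1
      thus ?thesis using card_K by (simp add: sum_power_eq_0)
    next
      case 2
      have "2 * s + s = card K - 1" using card_K by simp
      thus ?thesis using 2 sum_power_card_minus_1 by simp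
    next
      case 3
      have "2 * s + i = card K - 1 + (i - s)" using 3 card_K by simp
      hence "(\<Sum>x\<in>K. x ^ (2 * s + i)) = (\<Sum>x\<in>K. x ^ (i - s))"
        using sum_power_add_period[of "i - s"] 3 by simp
      also have "\<dots> = 0" using that card_K s_pos by (intro sum_power_eq_0) simp
      finally show ?thesis using 3 by simp
    qed
  qed
  hence "(\<Sum>x\<in>K. x ^ (2 * s) * (1 - x) ^ (2 * s)) =
    (\<Sum>i\<le>2 * s. of_nat ((2 * s) choose i) * (- 1) ^ i * (if i = s then - 1 else 0))"
    unfolding sum_power_mult_power_eq by (intro sum.cong) auto
  also have "\<dots> = (\<Sum>i\<le>2 * s. if i = s then - of_nat ((2 * s) choose s) else 0)"
    by (intro sum.cong) (auto simp: minus_one_power_s)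
  finally show ?thesis by (simp add: sum.delta)
qed

text \<open>Expanded in cyclotomic numbers, the two preceding sums are exchanged by swapping
  \<open>w\<close> and \<open>w ^ 2\<close>, and together they make up the trace.\<close>

lemma of_int_trace: "of_int trace = - (of_nat ((2 * s) choose s) :: 'a)"
proof -
  have drop: "(\<Sum>x\<in>K. x ^ a * (1 - x) ^ a) = (\<Sum>x\<in>K - {0, 1}. x ^ a * (1 - x) ^ a)" if "a > 0" for a
    using finite_K that by (intro sum.mono_neutral_right) (auto simp: power_0_left)
  have 1: "of_nat (3 * d0 + 2) + 3 * of_nat d1 * w + 3 * of_nat d2 * w ^ 2 = 0"
    using sum_power_s_mult sum_cyc[of "\<lambda>c d. c * d"] drop[OF s_pos]
    by (simp add: algebra_simps)
  have 2: "of_nat (3 * d0 + 2) + 3 * of_nat d1 * w ^ 2 + 3 * of_nat d2 * w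
      = - (of_nat ((2 * s) choose s) :: 'a)"
    using sum_power_2s_mult sum_cyc[of "\<lambda>c d. c ^ 2 * d ^ 2"] drop[of "2 * s"] s_pos
    by (simp add: algebra_simps flip: power_mult)
  have "trace = 2 * int (3 * d0 + 2) - 3 * int d1 - 3 * int d2"
    using card_K s_eq_row_1 by (simp add: trace_def)
  hence "(of_int trace :: 'a) = 2 * of_nat (3 * d0 + 2) - 3 * of_nat d1 - 3 * of_nat d2"
    by (simp only: of_int_diff of_int_mult of_int_of_nat_eq of_int_numeral)
  \<comment> \<open>Subtracting a multiple of \<open>w ^ 2 + w + 1 = 0\<close> makes this a
    polynomial identity in \<open>w\<close>.\<close>
  also have "\<dots> = (of_nat (3 * d0 + 2) + 3 * of_nat d1 * w + 3 * of_nat d2 * w ^ 2)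
    + (of_nat (3 * d0 + 2) + 3 * of_nat d1 * w ^ 2 + 3 * of_nat d2 * w)
    - (w ^ 2 + w + 1) * (3 * of_nat d1 + 3 * of_nat d2)"
    by (simp add: algebra_simps del: of_nat_add of_nat_mult w_mult)
  finally show ?thesis by (simp only: 1 2 w_eq) simp
qed

end

section \<open>The norm of the cubic Jacobi sum\<close>

definition zeta :: complex where "zeta = Complex (- 1 / 2) (sqrt 3 / 2)"

lemma zeta_simps [simp]:
  "zeta * zeta = cnj zeta" "zeta * cnj zeta = 1" "cnj zeta * zeta = 1" "cnj zeta * cnj zeta = zeta"
  "zeta \<noteq> 0" "zeta \<noteq> 1"
  by (simp_all add: zeta_def complex_eq_iff)

context cubic_subfield
begin

text \<open>A cubic character of \<open>K\<close>, factored through \<open>x \<mapsto> x ^ s\<close>; since \<open>0 ^ s = 0\<close>, it vanishes at \<open>0\<close>.\<close>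

definition embed :: "'a \<Rightarrow> complex" where
  "embed c = (if c = 1 then 1 else if c = w then zeta else if c = w ^ 2 then cnj zeta else 0)"

definition chi :: "'a \<Rightarrow> complex" where "chi x = embed (x ^ s)"

lemma embed_simps [simp]:
  "embed 0 = 0" "embed 1 = 1" "embed w = zeta" "embed (w ^ 2) = cnj zeta"
  by (simp_all add: embed_def)

lemma chi_0 [simp]: "chi 0 = 0" and chi_1 [simp]: "chi 1 = 1"
  using s_pos by (simp_all add: chi_def power_0_left)

lemma embed_mult: "\<lbrakk>c \<in> mu3; d \<in> mu3\<rbrakk> \<Longrightarrow> embed (c * d) = embed c * embed d"
  by (auto simp: mu3_def)

lemma embed_square: "c \<in> mu3 \<Longrightarrow> embed c * embed c = cnj (embed c)"
  by (auto simp: mu3_def)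

lemma embed_norm: "c \<in> mu3 \<Longrightarrow> embed c * cnj (embed c) = 1"
  by (auto simp: mu3_def)

lemma chi_mult:
  assumes "x \<in> K" "y \<in> K"
  shows "chi (x * y) = chi x * chi y"
proof (cases "x = 0 \<or> y = 0")
  case False
  thus ?thesis using assms
    by (simp add: chi_def power_mult_distrib embed_mult power_s_mem_mu3)
qed auto

lemma chi_square: "x \<in> K \<Longrightarrow> chi x * chi x = cnj (chi x)"
  by (cases "x = 0") (simp_all add: chi_def embed_square power_s_mem_mu3 s_pos power_0_left)

lemma chi_divide:
  assumes "x \<in> K" "y \<in> K" "y \<noteq> 0"
  shows "chi (x / y) = chi x * cnj (chi y)"
proof -
  have "chi (x / y) * chi y = chi x"
    using chi_mult[of "x / y" y] assms by (simp add: K_mem)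
  moreover have "chi y * cnj (chi y) = 1"
    using assms by (simp add: chi_def embed_norm power_s_mem_mu3)
  ultimately show ?thesis by (metis mult.assoc mult.right_neutral)
qed

text \<open>Rescaling by a unit with \<open>chi y = zeta\<close> multiplies the sum over all of
  \<open>K\<close> by \<open>zeta\<close>, so that sum is 0; omitting \<open>chi 1 = 1\<close>
  leaves -1.\<close>

lemma sum_chi: "(\<Sum>x\<in>K - {0, 1}. chi x) = - 1"
proof -
  obtain y where "y \<in> K" "y \<noteq> 0" "y ^ s = w"
    using ex_power_s_eq[of w] by (auto simp: mu3_def)
  hence y: "y \<in> K" "y \<noteq> 0" "chi y = zeta" by (simp_all add: chi_def)
  have "(\<Sum>x\<in>K. chi x) = (\<Sum>x\<in>K. chi (y * x))"
    by (rule sum.reindex_bij_witness[of _ "\<lambda>x. y * x" "\<lambda>x. x / y"]) (use y in \<open>auto intro: K_mem\<close>)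
  also have "\<dots> = zeta * (\<Sum>x\<in>K. chi x)"
    using y by (simp add: chi_mult sum_distrib_left)
  finally have "(\<Sum>x\<in>K. chi x) = 0" by simp
  moreover have "(\<Sum>x\<in>K. chi x) = (\<Sum>x\<in>K - {0, 1}. chi x) + (\<Sum>x\<in>{0, 1}. chi x)"
    using finite_K K_mem by (intro sum.subset_diff) auto
  ultimately show ?thesis by (simp add: add_eq_0_iff2)
qed

definition jacobi :: complex where "jacobi = (\<Sum>r\<in>K - {0, 1}. chi r * chi (1 - r))"

text \<open>Substituting \<open>u = a / b\<close> and \<open>v = (1 - a) / (1 - b)\<close>.\<close>

lemma jacobi_norm: "jacobi * cnj jacobi = of_nat (card K)"
proof -
  let ?K = "K - {0, 1}"
  let ?D = "{p \<in> ?K \<times> ?K. fst p = snd p}"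
  let ?E = "{p \<in> ?K \<times> ?K. fst p \<noteq> snd p}"
  let ?f = "\<lambda>(a, b). chi (a / b) * chi ((1 - a) / (1 - b))"
  let ?g = "\<lambda>(u, v). chi u * chi v"
  have fin: "finite ?K" using finite_K by simp
  have D: "sum h ?D = (\<Sum>a\<in>?K. h (a, a))" for h :: "'a \<times> 'a \<Rightarrow> complex"
    by (rule sum.reindex_bij_witness[of _ "\<lambda>a. (a, a)" fst]) auto
  have off_diag: "sum h (?K \<times> ?K) = sum h ?E + sum h ?D" for h :: "'a \<times> 'a \<Rightarrow> complex"
  proof -
    have "?K \<times> ?K = ?E \<union> ?D" by auto
    moreover have "sum h (?E \<union> ?D) = sum h ?E + sum h ?D"
      using fin by (intro sum.union_disjoint) auto
    ultimately show ?thesis by simp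
  qed
  have "jacobi * cnj jacobi = sum ?f (?K \<times> ?K)"
    unfolding jacobi_def cnj_sum sum_product sum.cartesian_product
  proof (rule sum.cong, goal_cases)
    case (2 p)
    obtain a b where p: "p = (a, b)" by force
    have "chi (a / b) = chi a * cnj (chi b)" "chi ((1 - a) / (1 - b)) = chi (1 - a) * cnj (chi (1 - b))"
      using 2 p by (auto intro!: chi_divide K_mem)
    thus ?case by (simp add: p)
  qed simp
  also have "\<dots> = sum ?f ?E + sum ?f ?D" by (rule off_diag)
  also have "sum ?f ?D = (\<Sum>a\<in>?K. 1)"
    unfolding D by (rule sum.cong) auto
  also have "\<dots> = of_nat (card K) - 2"
    using finite_K card_ge_2 K_mem by (simp add: card_Diff_subset of_nat_diff)
  \<comment> \<open>Solving for the old variables gives \<open>b = (v - 1) / (v - u)\<close> and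
    \<open>a = u * b\<close>. Since \<open>u = v\<close> only if \<open>a = b\<close>, off-diagonal
    pairs correspond to off-diagonal pairs.\<close>
  also have "sum ?f ?E = sum ?g ?E"
  proof (rule sum.reindex_bij_witness[of _
        "\<lambda>(u, v). (u * ((v - 1) / (v - u)), (v - 1) / (v - u))"
        "\<lambda>(a, b). (a / b, (1 - a) / (1 - b))"])
    fix p assume p: "p \<in> ?E"
    obtain a b where ab: "p = (a, b)" by force
    have h: "a \<in> K" "b \<in> K" "a \<noteq> 0" "a \<noteq> 1" "b \<noteq> 0" "b \<noteq> 1" "a \<noteq> b"
      using p ab by auto
    have nz: "1 - b \<noteq> 0" "b - a \<noteq> 0" "1 - a \<noteq> 0" using h by auto
    have vu: "(1 - a) / (1 - b) - a / b = (b - a) / (b * (1 - b))"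
      using h nz by (simp add: field_simps)
    have v1: "(1 - a) / (1 - b) - 1 = (b - a) / (1 - b)"
      using h nz by (simp add: field_simps)
    have q: "((1 - a) / (1 - b) - 1) / ((1 - a) / (1 - b) - a / b) = b"
      unfolding vu v1 using h nz by simp
    show "(case case p of (a, b) \<Rightarrow> (a / b, (1 - a) / (1 - b)) of
            (u, v) \<Rightarrow> (u * ((v - 1) / (v - u)), (v - 1) / (v - u))) = p"
      unfolding ab prod.case q using h by simp
    have "a / b \<noteq> 1" "(1 - a) / (1 - b) \<noteq> 1" using h nz by (simp_all add: divide_eq_eq)
    moreover have "a / b \<noteq> (1 - a) / (1 - b)" using vu h nz by auto
    ultimately show "(case p of (a, b) \<Rightarrow> (a / b, (1 - a) / (1 - b))) \<in> ?E"
      unfolding ab prod.case mem_Collect_eq fst_conv snd_conv using h nz by (simp add: K_mem)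
    show "?g (case p of (a, b) \<Rightarrow> (a / b, (1 - a) / (1 - b))) = ?f p"
      by (simp add: ab)
  next
    fix p assume p: "p \<in> ?E"
    obtain u v where uv: "p = (u, v)" by force
    have h: "u \<in> K" "v \<in> K" "u \<noteq> 0" "u \<noteq> 1" "v \<noteq> 0" "v \<noteq> 1" "u \<noteq> v"
      using p uv by auto
    define b where "b = (v - 1) / (v - u)"
    have nz: "v - u \<noteq> 0" "v - 1 \<noteq> 0" "1 - u \<noteq> 0" using h by auto
    have b1: "1 - b = (1 - u) / (v - u)" using nz by (simp add: b_def field_simps)
    have a1: "1 - u * b = v * (1 - b)" unfolding b1 using nz by (simp add: b_def field_simps)
    have bnz: "b \<noteq> 0" "1 - b \<noteq> 0" "1 - u * b \<noteq> 0"
      unfolding a1 unfolding b1 using nz h by (simp_all add: b_def)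
    have bK: "b \<in> K" unfolding b_def using h by (intro K_mem)
    show "(case case p of (u, v) \<Rightarrow> (u * ((v - 1) / (v - u)), (v - 1) / (v - u)) of
            (a, b) \<Rightarrow> (a / b, (1 - a) / (1 - b))) = p"
      unfolding uv prod.case b_def[symmetric] using bnz a1 by simp
    show "(case p of (u, v) \<Rightarrow> (u * ((v - 1) / (v - u)), (v - 1) / (v - u))) \<in> ?E"
      unfolding uv prod.case b_def[symmetric] mem_Collect_eq fst_conv snd_conv
      using bnz h bK by (simp add: K_mem)
  qed
  also have "sum ?g ?E = sum ?g (?K \<times> ?K) - sum ?g ?D" by (simp only: off_diag add_diff_cancel_right')
  also have "sum ?g (?K \<times> ?K) = (\<Sum>u\<in>?K. chi u) * (\<Sum>v\<in>?K. chi v)"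
    by (simp add: sum_product sum.cartesian_product)
  also have "sum ?g ?D = (\<Sum>u\<in>?K. cnj (chi u))"
    unfolding D by (rule sum.cong) (auto simp: chi_square)
  also have "\<dots> = cnj (\<Sum>u\<in>?K. chi u)" by simp
  \<comment> \<open>The full product contributes 1, removing its diagonal another 1, and the
    diagonal \<open>a = b\<close> contributes \<open>card K - 2\<close>.\<close>
  finally show ?thesis by (simp only: sum_chi) simp
qed

text \<open>Four times the norm identity, with real part \<open>trace / 2\<close> and imaginary part
  \<open>3 * sqrt 3 / 2 * (d1 - d2)\<close>.\<close>

theorem trace_norm: "4 * int (card K) = trace ^ 2 + 27 * (int d1 - int d2) ^ 2"
proof -
  have J: "jacobi = of_nat (3 * d0 + 2) + of_nat (3 * d1) * zeta + of_nat (3 * d2) * cnj zeta"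
    using sum_cyc[of "\<lambda>c d. embed c * embed d"]
    by (simp add: jacobi_def chi_def algebra_simps)
  have "trace = 2 * int (3 * d0 + 2) - 3 * int d1 - 3 * int d2"
    using card_K s_eq_row_1 by (simp add: trace_def)
  hence t: "real_of_int trace = 2 * real (3 * d0 + 2) - 3 * real d1 - 3 * real d2"
    by (simp only: of_int_diff of_int_mult of_int_of_nat_eq of_int_numeral)
  have re: "Re jacobi = real_of_int trace / 2"
    unfolding J t by (simp add: zeta_def field_simps)
  have im: "Im jacobi = 3 * sqrt 3 / 2 * (real d1 - real d2)"
    unfolding J by (simp add: zeta_def field_simps)
  have "real (card K) = (Re jacobi)\<^sup>2 + (Im jacobi)\<^sup>2"
    using arg_cong[OF jacobi_norm, of Re] by (simp add: power2_eq_square)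
  hence "real_of_int (4 * int (card K)) = real_of_int (trace ^ 2 + 27 * (int d1 - int d2) ^ 2)"
    unfolding re im by (simp add: power_mult_distrib power_divide)
  thus ?thesis by (simp only: of_int_eq_iff)
qed

end

section \<open>Counting the permutation binomials\<close>

text \<open>Two coprime powers of \<open>x / y\<close> are 1, so by Bezout \<open>x / y\<close>
  itself is 1.\<close>

lemma eq_of_coprime_powers:
  fixes x y :: "'a::field"
  assumes "x ^ m = y ^ m" "x ^ n = y ^ n" "coprime m n" "m > 0" "y \<noteq> 0"
  shows "x = y"
proof -
  obtain i j where ij: "m * i = n * j + 1"
    using bezout_nat[of m n] assms by auto
  define t where "t = x / y"
  have t: "t ^ m = 1" "t ^ n = 1" using assms by (simp_all add: t_def power_divide)
  have "1 = t ^ (m * i)" using t by (simp add: power_mult)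
  also have "\<dots> = t" unfolding ij power_add power_mult t by simp
  finally show ?thesis using assms by (simp add: t_def)
qed

context cubic_subfield
begin

text \<open>Taking \<open>s\<close>-th powers, the binomial descends to a map of
  \<open>z = x ^ s\<close>; a root of \<open>z + a\<close> in \<open>mu3\<close> would give the
  binomial a second zero. Conversely, injectivity on \<open>mu3\<close> recovers
  \<open>x ^ s\<close> from the value, cancelling \<open>x ^ s + a\<close> recovers
  \<open>x ^ n\<close>, and coprimality recovers \<open>x\<close>.\<close>

lemma inj_on_power_mult_iff:
  assumes "n > 0" "coprime n s" "a \<in> K"
  shows "inj_on (\<lambda>x. x ^ n * (x ^ s + a)) K \<longleftrightarrow>
    (\<forall>z\<in>mu3. z + a \<noteq> 0) \<and> inj_on (\<lambda>z. z ^ n * (z + a) ^ s) mu3"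
    (is "inj_on ?f K \<longleftrightarrow> ?nz \<and> inj_on ?u mu3")
proof
  have f_power: "?f x ^ s = ?u (x ^ s)" for x
    by (simp add: power_mult_distrib mult.commute flip: power_mult)
  have f0: "?f 0 = 0" using assms by simp
  {
    assume inj: "inj_on ?f K"
    have ?nz
    proof (intro ballI notI)
      fix z assume z: "z \<in> mu3" "z + a = 0"
      obtain x where x: "x \<in> K" "x \<noteq> 0" "x ^ s = z" using ex_power_s_eq z by metis
      have "?f x = ?f 0" using f0 x z by simp
      hence "x = 0" using inj_onD[OF inj] x zero_mem by blast
      thus False using x by simp
    qed
    \<comment> \<open>Injectivity on the finite set \<open>K\<close> gives surjectivity, which
      passes to the induced map.\<close>
    moreover have "mu3 \<subseteq> ?u ` mu3"
    proof
      fix c assume "c \<in> mu3"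
      then obtain y where y: "y \<in> K" "y \<noteq> 0" "y ^ s = c" using ex_power_s_eq by metis
      have "?f ` K = K"
        using inj finite_K assms by (intro endo_inj_surj) (auto intro: K_mem)
      hence "y \<in> ?f ` K" using y by simp
      then obtain x where x: "x \<in> K" "y = ?f x" by (rule imageE)
      hence "x \<noteq> 0" using y f0 by metis
      moreover have "c = ?u (x ^ s)" using f_power[of x] x y by simp
      ultimately show "c \<in> ?u ` mu3" using x power_s_mem_mu3 by blast
    qed
    hence "card mu3 \<le> card (?u ` mu3)" by (intro card_mono) (auto simp: finite_mu3)
    hence "inj_on ?u mu3"
      by (intro eq_card_imp_inj_on finite_mu3 antisym card_image_le)
    ultimately show "?nz \<and> inj_on ?u mu3" by blast
  }
  assume R: "?nz \<and> inj_on ?u mu3"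
  have f_eq_0: "x = 0" if "x \<in> K" "?f x = 0" for x
    using that R power_s_mem_mu3[of x] by (cases "x = 0") auto
  show "inj_on ?f K"
  proof (rule inj_onI)
    fix x y assume xy: "x \<in> K" "y \<in> K" "?f x = ?f y"
    show "x = y"
    proof (cases "x = 0 \<or> y = 0")
      case True
      thus ?thesis using xy f_eq_0[of x] f_eq_0[of y] f0 by metis
    next
      case False
      hence mem: "x ^ s \<in> mu3" "y ^ s \<in> mu3" using xy power_s_mem_mu3 by auto
      have "?u (x ^ s) = ?u (y ^ s)" using xy f_power by metis
      hence eq: "x ^ s = y ^ s" using R mem by (blast dest: inj_onD)
      moreover have "x ^ s + a \<noteq> 0" using R mem by blast
      ultimately have "x ^ n = y ^ n" using xy by simp
      thus ?thesis using eq_of_coprime_powers[of x n y s] eq assms False by simp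
    qed
  qed
qed

text \<open>In exponents of \<open>w\<close>: three residues modulo 3 sum to 0 exactly when they are
  all equal or all different.\<close>

lemma distinct_mu3_iff:
  assumes "x \<in> mu3" "y \<in> mu3" "z \<in> mu3"
  shows "x \<noteq> y \<and> x \<noteq> z \<and> y \<noteq> z \<longleftrightarrow> x * y * z = 1 \<and> \<not> (x = y \<and> x = z)"
  using assms by (auto simp: mu3_def)

lemma prod_add_mu3: "(1 + a) * (w + a) * (w ^ 2 + a) = 1 + a ^ 3"
proof -
  have "(1 + a) * (w + a) * (w ^ 2 + a) - (1 + a ^ 3) =
    (w ^ 2 + w + 1) * a ^ 2 + w * (w ^ 2 + w + 1) * a + w ^ 3 - 1"
    by (simp add: algebra_simps power2_eq_square power3_eq_cube del: w_mult)
  thus ?thesis by (simp add: w_eq w_cubed)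
qed

lemma w_power_eq_1_iff: "w ^ m = 1 \<longleftrightarrow> 3 dvd m"
proof -
  have "w ^ m = w ^ (3 * (m div 3) + m mod 3)" by simp
  also have "\<dots> = w ^ (m mod 3)" unfolding power_add power_mult w_cubed by simp
  finally have eq: "w ^ m = w ^ (m mod 3)" .
  have "m mod 3 = 0 \<or> m mod 3 = 1 \<or> m mod 3 = 2" by presburger
  thus ?thesis unfolding eq by (auto simp: dvd_eq_mod_eq_0)
qed

lemma w_power_mem_mu3: "w ^ m \<in> mu3"
  by (simp add: mu3_iff w_cubed mult.commute[of m] flip: power_mult)
     (simp add: w_cubed power_mult)

text \<open>The 1 accounts for \<open>a = 0\<close>. Otherwise \<open>r = - (a ^ 3)\<close> and
  \<open>1 - r\<close> both have trivial class, and each such \<open>r\<close> comes from three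
  values of \<open>a\<close>.\<close>

lemma card_cube_plus_one: "card {a \<in> K. (1 + a ^ 3) ^ s = 1} = 1 + 3 * d0"
proof -
  define A where "A = {a \<in> K - {0}. - (a ^ 3) \<in> cyc 1 1}"
  have finA: "finite A" using finite_K by (simp add: A_def)
  have "{a \<in> K. (1 + a ^ 3) ^ s = 1} = insert 0 A"
  proof (intro equalityI subsetI)
    fix a assume "a \<in> {a \<in> K. (1 + a ^ 3) ^ s = 1}"
    hence a: "a \<in> K" "(1 + a ^ 3) ^ s = 1" by auto
    have "(- (a ^ 3)) ^ s = 1" if "a \<noteq> 0"
      using power_card_minus_1[of a] that a card_K unfolding uminus_power_s by (simp flip: power_mult)
    moreover have "- (a ^ 3) \<noteq> 1"
    proof
      assume "- (a ^ 3) = 1"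
      hence "1 + a ^ 3 = 0" by (metis add.right_inverse minus_minus add.inverse_inverse add_eq_0_iff)
      thus False using a s_pos by (simp add: power_0_left)
    qed
    ultimately show "a \<in> insert 0 A" using a by (auto simp: A_def cyc_def K_mem)
  next
    fix a assume "a \<in> insert 0 A"
    thus "a \<in> {a \<in> K. (1 + a ^ 3) ^ s = 1}" by (auto simp: A_def cyc_def K_mem)
  qed
  moreover have "card A = 3 * d0"
  proof -
    have "(\<lambda>a. - (a ^ 3)) ` A \<subseteq> cyc 1 1" by (auto simp: A_def)
    hence "card A = (\<Sum>r\<in>cyc 1 1. card {a \<in> A. - (a ^ 3) = r})"
      using sum.group[OF finA finite_cyc, of "\<lambda>a. - (a ^ 3)" 1 1 "\<lambda>_. 1::nat"] by simp
    also have "\<dots> = (\<Sum>r\<in>cyc 1 1. 3)"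
    proof (rule sum.cong)
      fix r assume r: "r \<in> cyc 1 1"
      hence "{a \<in> A. - (a ^ 3) = r} = {a \<in> K - {0}. a ^ 3 = - r}"
        by (auto simp: A_def)
      thus "card {a \<in> A. - (a ^ 3) = r} = 3"
        using r card_cube_fibre[of "- r"] by (simp add: cyc_def K_mem uminus_power_s)
    qed simp
    finally show ?thesis by (simp add: d0_def)
  qed
  moreover have "0 \<notin> A" by (simp add: A_def)
  ultimately show ?thesis using finA by simp
qed

text \<open>The \<open>a\<close> for which the three induced values have product 1 without being
  distinct; they have to be removed from the count above.\<close>

definition all_equal :: "nat \<Rightarrow> 'a set" where
  "all_equal n = {a \<in> K. (\<forall>z\<in>mu3. z + a \<noteq> 0) \<and>
     (1 + a) ^ s = w ^ n * (w + a) ^ s \<and> (1 + a) ^ s = (w ^ 2) ^ n * (w ^ 2 + a) ^ s}"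

lemma card_permuting_eq:
  assumes "n > 0" "coprime n s"
  shows "card {a \<in> K. inj_on (\<lambda>x. x ^ n * (x ^ s + a)) K} + card (all_equal n) = 1 + 3 * d0"
proof -
  let ?T = "{a \<in> K. (1 + a ^ 3) ^ s = 1}"
  let ?P = "{a \<in> K. inj_on (\<lambda>x. x ^ n * (x ^ s + a)) K}"
  have nz: "(\<forall>z\<in>mu3. z + a \<noteq> 0) \<longleftrightarrow> 1 + a ^ 3 \<noteq> 0" for a
    by (simp add: mu3_def flip: prod_add_mu3)
  have key: "a \<in> ?P \<longleftrightarrow> (\<forall>z\<in>mu3. z + a \<noteq> 0) \<and> (1 + a ^ 3) ^ s = 1 \<and> a \<notin> all_equal n"
    and sub: "a \<in> all_equal n \<Longrightarrow> (1 + a ^ 3) ^ s = 1" if a: "a \<in> K" for a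
  proof -
    define x y z where xyz: "x = (1 + a) ^ s" "y = w ^ n * (w + a) ^ s" "z = (w ^ 2) ^ n * (w ^ 2 + a) ^ s"
    \<comment> \<open>The factors \<open>z ^ n\<close> over \<open>mu3\<close> multiply to 1 and
      drop out of the product of the three values.\<close>
    have "w ^ n * (w ^ 2) ^ n = 1" by (simp flip: power_mult_distrib)
    moreover have "x * y * z = (w ^ n * (w ^ 2) ^ n) * ((1 + a) * (w + a) * (w ^ 2 + a)) ^ s"
      by (simp only: xyz power_mult_distrib mult_ac)
    ultimately have "x * y * z = ((1 + a) * (w + a) * (w ^ 2 + a)) ^ s" by simp
    hence prod: "x * y * z = (1 + a ^ 3) ^ s" by (simp only: prod_add_mu3)
    have mem: "x \<in> mu3 \<and> y \<in> mu3 \<and> z \<in> mu3" if "\<forall>z\<in>mu3. z + a \<noteq> 0"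
    proof -
      have "(1 + a) ^ s \<in> mu3" "(w + a) ^ s \<in> mu3" "(w ^ 2 + a) ^ s \<in> mu3"
        using that by (auto intro!: power_s_mem_mu3 K_mem w_mem a) (auto simp: mu3_def)
      moreover have "w ^ n \<in> mu3" "(w ^ 2) ^ n \<in> mu3"
        using w_power_mem_mu3[of n] w_power_mem_mu3[of "2 * n"] by (simp_all add: power_mult)
      ultimately show ?thesis by (simp add: xyz mu3_iff power_mult_distrib)
    qed
    have inj: "inj_on (\<lambda>z. z ^ n * (z + a) ^ s) mu3 \<longleftrightarrow> x \<noteq> y \<and> x \<noteq> z \<and> y \<noteq> z"
      by (auto simp: mu3_def xyz)
    have E: "a \<in> all_equal n \<longleftrightarrow> (\<forall>z\<in>mu3. z + a \<noteq> 0) \<and> x = y \<and> x = z"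
      using a by (auto simp: all_equal_def xyz)
    show "a \<in> ?P \<longleftrightarrow> (\<forall>z\<in>mu3. z + a \<noteq> 0) \<and> (1 + a ^ 3) ^ s = 1 \<and> a \<notin> all_equal n"
      using a inj_on_power_mult_iff[OF assms a] inj E mem distinct_mu3_iff[of x y z] prod
      by auto
    show "(1 + a ^ 3) ^ s = 1" if "a \<in> all_equal n"
      using that E mem prod mu3_iff[of x] by (auto simp: power3_eq_cube)
  qed
  have "?T = ?P \<union> all_equal n"
  proof (intro equalityI subsetI)
    fix a assume "a \<in> ?T"
    hence a: "a \<in> K" "(1 + a ^ 3) ^ s = 1" by auto
    hence "1 + a ^ 3 \<noteq> 0" using s_pos by (auto simp: power_0_left)
    thus "a \<in> ?P \<union> all_equal n" using key a nz by auto
  next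
    fix a assume "a \<in> ?P \<union> all_equal n"
    thus "a \<in> ?T" using key sub by (auto simp: all_equal_def)
  qed
  moreover have "?P \<inter> all_equal n = {}" using key by auto
  moreover have "finite ?P" "finite (all_equal n)"
    using finite_K by (simp_all add: all_equal_def)
  ultimately show ?thesis
    using card_cube_plus_one card_Un_disjoint[of ?P "all_equal n"] by simp
qed

text \<open>The Moebius map \<open>a \<mapsto> r\<close> turns the three-term condition into one on \<open>r\<close> and \<open>1 - r\<close>;
  the value \<open>r = - w\<^sup>2\<close> is the image of infinity.\<close>

lemma card_all_equal:
  "card (all_equal n) + (if 3 dvd n then 1 else 0) = (if w ^ (2 * s + n) = 1 then d0 else d0 + 1)"
proof -
  \<comment> \<open>\<open>c\<close> is the class required of \<open>r = f a\<close>: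
    \<open>w ^ (2 * s)\<close> comes from the constant \<open>- (w ^ 2)\<close> in \<open>f\<close>,
    and \<open>w ^ n\<close> from equality of the values. The class of \<open>1 - r\<close> then has
    to be \<open>c ^ 2\<close>.\<close>
  define c where "c = w ^ (2 * s + n)"
  \<comment> \<open>\<open>f\<close> sends \<open>- 1\<close>, \<open>- (w ^ 2)\<close> and
    \<open>- w\<close> to 0, 1 and infinity; \<open>g\<close> is its inverse.\<close>
  define f where "f = (\<lambda>a. - (w ^ 2) * (a + 1) / (a + w))"
  define g where "g = (\<lambda>r. - (w ^ 2 + r * w) / (r + w ^ 2))"
  define W where "W = w ^ n"
  define S where "S = w ^ s"
  have WS: "W ^ 3 = 1" "S ^ 3 = 1" "W \<noteq> 0" "S \<noteq> 0"
    using w_power_mem_mu3 by (auto simp: W_def S_def mu3_iff)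
  have c: "c = S ^ 2 * W" and c2: "c ^ 2 = S * W ^ 2"
  proof -
    show 1: "c = S ^ 2 * W"
      by (simp add: c_def S_def W_def power_add mult.commute[of 2] power_mult)
    have "c ^ 2 = S ^ 3 * S * W ^ 2" unfolding 1
      by (simp add: power2_eq_square power3_eq_cube mult_ac)
    thus "c ^ 2 = S * W ^ 2" using WS by simp
  qed
  have nz3: "(\<forall>z\<in>mu3. z + a \<noteq> 0) \<longleftrightarrow> a + 1 \<noteq> 0 \<and> a + w \<noteq> 0 \<and> a + w ^ 2 \<noteq> 0" for a
    by (simp add: mu3_def add.commute)
  have one_minus_f: "1 - f a = - w * (a + w ^ 2) / (a + w)" if "a + w \<noteq> 0" for a
  proof -
    have "1 - f a = ((a + w) + w ^ 2 * (a + 1)) / (a + w)"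
      using that by (simp add: f_def field_simps)
    also have "(a + w) + w ^ 2 * (a + 1) = - w * (a + w ^ 2) + (w ^ 2 + w + 1) * a + (w ^ 2 + w + w * w ^ 2)"
      by (simp add: algebra_simps del: w_mult)
    also have "\<dots> = - w * (a + w ^ 2)" using w_eq by simp
    finally show ?thesis .
  qed
  have f_iff: "f a \<in> cyc c (c ^ 2) - {- (w ^ 2)} \<longleftrightarrow> a \<in> all_equal n"
    if "a \<in> K" "a + 1 \<noteq> 0" "a + w \<noteq> 0" "a + w ^ 2 \<noteq> 0" for a
  proof -
    define X Y Z where XYZ: "X = (a + 1) ^ s" "Y = (a + w) ^ s" "Z = (a + w ^ 2) ^ s"
    have "Y \<noteq> 0" using that by (simp add: XYZ)
    have "f a \<in> K" using that by (auto simp: f_def intro!: K_mem w_mem)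
    moreover have "f a \<noteq> 0" using that by (simp add: f_def)
    moreover have "1 - f a \<noteq> 0" using that one_minus_f by simp
    hence "f a \<noteq> 1" by auto
    moreover have "f a \<noteq> - (w ^ 2)"
      using that by (auto simp: f_def divide_eq_eq)
    moreover have "f a ^ s = S ^ 2 * X / Y"
    proof -
      have "f a = - (w ^ 2 * (a + 1) / (a + w))" by (simp add: f_def)
      hence "f a ^ s = (w ^ 2) ^ s * (a + 1) ^ s / (a + w) ^ s"
        by (simp only: uminus_power_s power_mult_distrib power_divide)
      thus ?thesis by (simp add: XYZ S_def mult.commute flip: power_mult)
    qed
    moreover have "(1 - f a) ^ s = S * Z / Y"
    proof -
      have "1 - f a = - (w * (a + w ^ 2) / (a + w))" using that one_minus_f by simp
      thus ?thesis by (simp only: uminus_power_s power_mult_distrib power_divide XYZ S_def)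
    qed
    ultimately have "f a \<in> cyc c (c ^ 2) - {- (w ^ 2)} \<longleftrightarrow>
      S ^ 2 * X / Y = S ^ 2 * W \<and> S * Z / Y = S * W ^ 2"
      by (simp add: cyc_def c2 flip: c)
    also have "\<dots> \<longleftrightarrow> X = W * Y \<and> Z = W ^ 2 * Y"
      using \<open>Y \<noteq> 0\<close> WS by (simp add: divide_eq_eq mult.assoc)
    also have "\<dots> \<longleftrightarrow> X = W * Y \<and> X = W ^ 2 * Z"
    proof -
      have "W * Y = W ^ 2 * Z \<longleftrightarrow> Z = W ^ 2 * Y"
      proof
        assume "W * Y = W ^ 2 * Z"
        hence "W ^ 2 * Y = W ^ 3 * Z" using WS by (simp add: power2_eq_square power3_eq_cube mult.assoc)
        thus "Z = W ^ 2 * Y" using WS by simp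
      next
        assume "Z = W ^ 2 * Y"
        hence "W ^ 2 * Z = W ^ 3 * (W * Y)" by (simp add: power2_eq_square power3_eq_cube mult.assoc)
        thus "W * Y = W ^ 2 * Z" using WS by simp
      qed
      thus ?thesis by auto
    qed
    also have "\<dots> \<longleftrightarrow> a \<in> all_equal n"
      using that nz3[of a]
      by (simp add: all_equal_def XYZ W_def add.commute mult.commute flip: power_mult)
    finally show ?thesis .
  qed
  have g_facts: "g r \<in> K \<and> g r + 1 \<noteq> 0 \<and> g r + w \<noteq> 0 \<and> g r + w ^ 2 \<noteq> 0 \<and> f (g r) = r"
    if r: "r \<in> K" "r \<noteq> 0" "r \<noteq> 1" "r \<noteq> - (w ^ 2)" for r
  proof -
    have nz: "r + w ^ 2 \<noteq> 0" using r by (metis eq_neg_iff_add_eq_0)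
    have nz': "1 - w \<noteq> 0" "1 - w ^ 2 \<noteq> 0" "1 - r \<noteq> 0" using r by auto
    have 1: "g r + 1 = r * (1 - w) / (r + w ^ 2)"
      using nz by (simp add: g_def field_simps)
    have 2: "g r + w = (1 - w ^ 2) / (r + w ^ 2)"
    proof -
      have "g r + w = (- (w ^ 2 + r * w) + w * (r + w ^ 2)) / (r + w ^ 2)"
        using nz by (simp add: g_def add_divide_distrib del: w_mult)
      thus ?thesis by (simp add: algebra_simps)
    qed
    have 3: "g r + w ^ 2 = w * (1 - w) * (1 - r) / (r + w ^ 2)"
    proof -
      have "g r + w ^ 2 = (- (w ^ 2 + r * w) + w ^ 2 * (r + w ^ 2)) / (r + w ^ 2)"
        using nz by (simp add: g_def add_divide_distrib del: w_mult)
      thus ?thesis by (simp add: algebra_simps)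
    qed
    have "f (g r) = - (w ^ 2) * (r * (1 - w)) / (1 - w ^ 2)"
      unfolding f_def 1 2 using nz by simp
    also have "- (w ^ 2) * (r * (1 - w)) = r * (1 - w ^ 2)"
      by (simp add: algebra_simps)
    finally have "f (g r) = r" using nz' by simp
    moreover have "g r \<in> K" unfolding g_def using r by (intro K_mem w_mem)
    ultimately show ?thesis unfolding 1 2 3 using nz nz' r by simp
  qed
  have gf: "g (f a) = a" if "a + w \<noteq> 0" for a
  proof -
    have 1: "f a + w ^ 2 = w ^ 2 * (w - 1) / (a + w)"
      using that by (simp add: f_def field_simps)
    have "w ^ 2 + f a * w = (w ^ 2 * (a + w) - (a + 1)) / (a + w)"
      using that by (simp add: f_def field_simps)
    also have "w ^ 2 * (a + w) - (a + 1) = a * (w ^ 2 - 1)" by (simp add: algebra_simps)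
    finally have 2: "w ^ 2 + f a * w = a * (w ^ 2 - 1) / (a + w)" .
    have "g (f a) = - (a * (w ^ 2 - 1)) / (w ^ 2 * (w - 1))"
      unfolding g_def 1 2 using that by simp
    also have "- (a * (w ^ 2 - 1)) = a * (w ^ 2 * (w - 1))" by (simp add: algebra_simps)
    finally show ?thesis by simp
  qed
  have "bij_betw f (all_equal n) (cyc c (c ^ 2) - {- (w ^ 2)})"
  proof (rule bij_betw_byWitness[where f' = g])
    have E: "a \<in> K" "a + 1 \<noteq> 0" "a + w \<noteq> 0" "a + w ^ 2 \<noteq> 0" if "a \<in> all_equal n" for a
      using that unfolding all_equal_def nz3 by blast+
    show "\<forall>a\<in>all_equal n. g (f a) = a" using E gf by blast
    show "f ` all_equal n \<subseteq> cyc c (c ^ 2) - {- (w ^ 2)}" 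
    proof (rule image_subsetI)
      fix a assume a: "a \<in> all_equal n"
      show "f a \<in> cyc c (c ^ 2) - {- (w ^ 2)}" using f_iff[OF E[OF a]] a by simp
    qed
    have C: "g r \<in> K \<and> g r + 1 \<noteq> 0 \<and> g r + w \<noteq> 0 \<and> g r + w ^ 2 \<noteq> 0 \<and> f (g r) = r"
      if "r \<in> cyc c (c ^ 2) - {- (w ^ 2)}" for r
      using that by (intro g_facts) (auto simp: cyc_def)
    show "\<forall>r\<in>cyc c (c ^ 2) - {- (w ^ 2)}. f (g r) = r" using C by blast
    show "g ` (cyc c (c ^ 2) - {- (w ^ 2)}) \<subseteq> all_equal n" 
    proof (rule image_subsetI)
      fix r assume "r \<in> cyc c (c ^ 2) - {- (w ^ 2)}"
      thus "g r \<in> all_equal n" using C[of r] f_iff[of "g r"] by simp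
    qed
  qed
  hence card_E: "card (all_equal n) = card (cyc c (c ^ 2) - {- (w ^ 2)})"
    by (rule bij_betw_same_card)
  \<comment> \<open>At \<open>r = - (w ^ 2)\<close> one has \<open>1 - r = - w\<close>, so the
    classes are \<open>S ^ 2\<close> and \<open>S\<close>; they match \<open>c = S ^ 2 * W\<close>
    and \<open>c ^ 2 = S * W ^ 2\<close> only for \<open>W = 1\<close>.\<close>
  have infty: "- (w ^ 2) \<in> cyc c (c ^ 2) \<longleftrightarrow> 3 dvd n"
  proof -
    have "1 - (- (w ^ 2)) + w = 0" using w_eq by (simp add: algebra_simps)
    hence "1 - (- (w ^ 2)) = - w" by (simp only: eq_neg_iff_add_eq_0)
    hence 1: "(1 - (- (w ^ 2))) ^ s = S" by (simp only: uminus_power_s S_def)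
    have 2: "(- (w ^ 2)) ^ s = S ^ 2"
      by (simp add: uminus_power_s S_def mult.commute flip: power_mult)
    have 3: "- (w ^ 2) \<noteq> 1"
    proof
      assume "- (w ^ 2) = 1"
      with \<open>1 - (- (w ^ 2)) = - w\<close> have "1 - 1 = - w" by (simp only:)
      thus False by simp
    qed
    have 4: "- (w ^ 2) \<in> K" "- (w ^ 2) \<noteq> 0" by (auto intro: K_mem w_mem)
    have "- (w ^ 2) \<in> cyc c (c ^ 2) \<longleftrightarrow> S ^ 2 = c \<and> S = c ^ 2"
      unfolding cyc_def mem_Collect_eq 1 2 using 3 4 by blast
    also have "\<dots> \<longleftrightarrow> W = 1" unfolding c2 unfolding c using WS by auto
    finally show ?thesis by (simp add: W_def w_power_eq_1_iff)
  qed
  \<comment> \<open>For \<open>c = w\<close> and \<open>c = w ^ 2\<close> the pair of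
    \<open>c\<close> and \<open>c ^ 2\<close> lies in the mixed orbit, hence
    \<open>d0 + 1\<close>.\<close>
  have "c \<in> mu3" by (simp add: c_def w_power_mem_mu3)
  hence "card (cyc c (c ^ 2)) = (if c = 1 then d0 else d0 + 1)"
    by (auto simp: mu3_def card_cyc_d0 d0_def)
  \<comment> \<open>Nonemptiness makes the natural-number subtraction of the image of infinity
    exact.\<close>
  moreover have "card (cyc c (c ^ 2)) > 0" if "3 dvd n"
    using infty that finite_cyc card_gt_0_iff by blast
  ultimately show ?thesis
    using card_E infty finite_cyc by (auto simp: c_def card_Diff_singleton)
qed

text \<open>Up to the corrections, \<open>all_equal n\<close> takes away one of the three copies of
  \<open>d0\<close>; the remaining \<open>18 * d0\<close> equals
  \<open>2 * (trace + card K - 8)\<close>.\<close>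

theorem card_permuting:
  assumes "n > 0" "coprime n s"
  shows "9 * int (card {a \<in> K. inj_on (\<lambda>x. x ^ n * (x ^ s + a)) K}) =
    2 * int (card K) - 7 + 2 * trace - (if 3 dvd 2 * s + n then 0 else 9) + (if 3 dvd n then 9 else 0)"
proof -
  have "int (card {a \<in> K. inj_on (\<lambda>x. x ^ n * (x ^ s + a)) K}) + int (card (all_equal n)) = 1 + 3 * int d0"
    using card_permuting_eq[OF assms] by linarith
  moreover have "int (card (all_equal n)) + (if 3 dvd n then 1 else 0) =
      (if 3 dvd 2 * s + n then int d0 else int d0 + 1)"
    using arg_cong[OF card_all_equal[of n], of int] unfolding w_power_eq_1_iff by (simp split: if_splits)
  ultimately show ?thesis unfolding trace_def by (auto split: if_splits)
qed

end

section \<open>Binomial coefficients modulo a prime and the form \<open>A\<^sup>2 + 27 B\<^sup>2\<close>\<close>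

text \<open>In Vandermonde's identity only \<open>p choose 0\<close> and \<open>p choose p\<close>
  survive modulo \<open>p\<close>; this is \<open>(1 + X) ^ p = 1 + X ^ p\<close> on
  coefficients.\<close>

lemma choose_prime_add_cong:
  assumes "prime (p::nat)"
  shows "[(p + n) choose k = (n choose k) + (if p \<le> k then n choose (k - p) else 0)] (mod p)"
proof -
  have p: "p > 0" using assms prime_gt_0_nat by blast
  have "[(\<Sum>i\<le>k. (p choose i) * (n choose (k - i))) =
      (\<Sum>i\<le>k. (if i = 0 then n choose k else 0) + (if i = p then n choose (k - p) else 0))] (mod p)"
  proof (rule cong_sum)
    fix i assume "i \<in> {..k}"
    show "[(p choose i) * (n choose (k - i)) =
      (if i = 0 then n choose k else 0) + (if i = p then n choose (k - p) else 0)] (mod p)"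
    proof (cases "i = 0 \<or> i \<ge> p")
      case True
      thus ?thesis using p by (cases "i = p") (auto simp: binomial_eq_0)
    next
      case False
      hence "p dvd (p choose i)" using assms by (intro dvd_choose_prime) auto
      thus ?thesis using False by (simp add: cong_0_iff)
    qed
  qed
  thus ?thesis by (simp add: vandermonde sum.distrib sum.delta)
qed

text \<open>Lucas' theorem for the last base-\<open>p\<close> digit: iterating the preceding
  congruence reproduces Pascal's rule for \<open>a choose c\<close>.\<close>

lemma lucas_choose_cong:
  assumes "prime (p::nat)" "b < p" "d < p"
  shows "[(p * a + b) choose (p * c + d) = (a choose c) * (b choose d)] (mod p)"
proof (induction a arbitrary: c)
  case 0
  have "b choose (p * c + d) = 0" if "c > 0"
  proof -
    have "p * 1 \<le> p * c" using that by (intro mult_le_mono2) simp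
    thus ?thesis using assms by (intro binomial_eq_0) linarith
  qed
  thus ?case by (cases "c = 0") (auto simp: binomial_eq_0)
next
  case (Suc a)
  have step: "[(p * Suc a + b) choose j =
      ((p * a + b) choose j) + (if p \<le> j then (p * a + b) choose (j - p) else 0)] (mod p)" for j
    using choose_prime_add_cong[OF assms(1), of "p * a + b" j] by (simp add: add.assoc)
  show ?case
  proof (cases c)
    case 0
    thus ?thesis using step[of d] Suc.IH[of 0] assms by (auto intro: cong_trans)
  next
    case (Suc c')
    have "[(p * Suc a + b) choose (p * c + d) =
        ((p * a + b) choose (p * c + d)) + ((p * a + b) choose (p * c' + d))] (mod p)"
      using step[of "p * c + d"] by (simp add: Suc)
    also have "[((p * a + b) choose (p * c + d)) + ((p * a + b) choose (p * c' + d)) =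
        (a choose c) * (b choose d) + (a choose c') * (b choose d)] (mod p)"
      by (intro cong_add Suc.IH)
    also have "(a choose c) * (b choose d) + (a choose c') * (b choose d) = (Suc a choose c) * (b choose d)"
      by (simp add: Suc algebra_simps)
    finally show ?thesis .
  qed
qed

lemma prime_not_dvd_choose:
  assumes "prime (p::nat)" "n < p" "k \<le> n"
  shows "\<not> p dvd (n choose k)"
proof
  assume "p dvd (n choose k)"
  hence "p dvd fact n" using binomial_fact_lemma[OF assms(3)] by (metis dvd_mult)
  thus False using assms prime_dvd_fact_iff by force
qed

text \<open>All base-\<open>p\<close> digits of \<open>(p ^ k - 1) div 3\<close> equal
  \<open>m = (p - 1) div 3\<close>. Doubling causes no carry, so by Lucas the coefficient is a power
  of \<open>(2 * m) choose m\<close> modulo \<open>p\<close>, where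
  \<open>2 * m < p\<close>.\<close>

lemma prime_not_dvd_middle_choose:
  assumes "prime (p::nat)" "p mod 3 = 1"
  shows "\<not> p dvd ((2 * ((p ^ k - 1) div 3)) choose ((p ^ k - 1) div 3))"
proof -
  define m where "m = (p - 1) div 3"
  have p: "p = 3 * m + 1" using assms(2) unfolding m_def by presburger
  have m: "2 * m < p" "m < p" using p by auto
  define t where "t = (\<lambda>k. (p ^ k - 1) div 3)"
  have "p ^ k mod 3 = 1" for k
    using power_mod[of p 3 k] assms(2) by simp
  hence t: "p ^ k = 3 * t k + 1" for k
    unfolding t_def using div_mult_mod_eq[of "p ^ k" 3] by (metis add_diff_cancel_right' mult.commute nonzero_mult_div_cancel_left zero_neq_numeral)
  have rec: "t (Suc k) = p * t k + m" for k
  proof -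
    have "3 * t (Suc k) + 1 = p * (3 * t k + 1)" using t[of "Suc k"] t[of k] by simp
    also have "\<dots> = 3 * (p * t k) + p" by (simp add: algebra_simps)
    finally show ?thesis using p by linarith
  qed
  have "\<not> p dvd ((2 * t k) choose t k)"
  proof (induction k)
    case 0
    show ?case using assms by (auto simp: t_def)
  next
    case (Suc k)
    have "2 * t (Suc k) = p * (2 * t k) + 2 * m" using rec[of k] by simp
    hence "[(2 * t (Suc k)) choose t (Suc k) = ((2 * t k) choose t k) * ((2 * m) choose m)] (mod p)"
      using lucas_choose_cong[OF assms(1) m, of "2 * t k" "t k"] rec[of k] by (simp only:)
    moreover have "\<not> p dvd ((2 * m) choose m)" using assms m by (intro prime_not_dvd_choose) auto
    ultimately show ?case
      using Suc.IH assms(1) by (simp add: cong_dvd_iff prime_dvd_mult_iff)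
  qed
  thus ?thesis by (simp add: t_def)
qed

text \<open>The factor \<open>3 m + j\<close> is half of \<open>2 j - 1\<close> modulo \<open>6 m + 1\<close>.\<close>

lemma fact_half_cong:
  fixes m :: nat
  shows "[4 ^ j * fact j * fact (3 * m + j) = fact (3 * m) * fact (2 * j)] (mod 6 * m + 1)"
proof (induction j)
  case 0
  show ?case by simp
next
  case (Suc j)
  have "4 ^ Suc j * fact (Suc j) * fact (3 * m + Suc j) =
      (2 * (j + 1) * ((6 * m + 1) + (2 * j + 1))) * (4 ^ j * fact j * fact (3 * m + j) :: nat)"
    by (simp add: algebra_simps)
  also have "[\<dots> = (2 * (j + 1) * (0 + (2 * j + 1))) * (fact (3 * m) * fact (2 * j))] (mod 6 * m + 1)"
    by (intro cong_mult cong_add Suc.IH cong_refl) (simp add: cong_0_iff)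
  also have "(2 * (j + 1) * (0 + (2 * j + 1))) * (fact (3 * m) * fact (2 * j)) =
      fact (3 * m) * (fact (2 * Suc j) :: nat)"
    by (simp add: algebra_simps)
  finally show ?case .
qed

text \<open>Converts the central coefficient of the trace congruence into the one defining
  \<open>kappa\<close>. The factorials of \<open>4 * m\<close> and \<open>3 * m\<close> in the
  preceding congruence at \<open>j = m\<close> are written with binomials, and the common factor is
  prime to \<open>6 * m + 1\<close>.\<close>

lemma middle_choose_cong:
  fixes m :: nat
  assumes "prime (6 * m + 1)"
  shows "[4 ^ m * ((4 * m) choose (2 * m)) = (3 * m) choose (2 * m)] (mod 6 * m + 1)"
proof -
  let ?c = "fact m * fact (2 * m) * fact (2 * m) :: nat"
  have "coprime (fact n) (6 * m + 1)" if "n \<le> 2 * m" for n :: nat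
  proof -
    have "\<not> (6 * m + 1) dvd fact n" using assms that by (subst prime_dvd_fact_iff) auto
    thus ?thesis using assms prime_imp_coprime coprime_commute by blast
  qed
  hence cop: "coprime ?c (6 * m + 1)" by (simp del: One_nat_def)
  have 1: "fact (4 * m) = ((4 * m) choose (2 * m)) * fact (2 * m) * (fact (2 * m) :: nat)"
    using binomial_fact_lemma[of "2 * m" "4 * m"] by (simp add: mult_ac)
  have 2: "fact (3 * m) = ((3 * m) choose (2 * m)) * fact (2 * m) * (fact m :: nat)"
    using binomial_fact_lemma[of "2 * m" "3 * m"] by (simp add: mult_ac)
  have "[4 ^ m * fact m * fact (3 * m + m) = fact (3 * m) * fact (2 * m)] (mod 6 * m + 1)"
    by (rule fact_half_cong)
  moreover have "4 ^ m * fact m * fact (3 * m + m) = ?c * (4 ^ m * ((4 * m) choose (2 * m)))"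
  proof -
    have "fact (3 * m + m) = (fact (4 * m) :: nat)" by (rule arg_cong[of _ _ fact]) simp
    thus ?thesis unfolding 1 by (simp only: mult_ac)
  qed
  moreover have "fact (3 * m) * fact (2 * m) = ?c * ((3 * m) choose (2 * m))"
    unfolding 2 by (simp only: mult_ac)
  ultimately have "[?c * (4 ^ m * ((4 * m) choose (2 * m))) = ?c * ((3 * m) choose (2 * m))] (mod 6 * m + 1)"
    by (simp only:)
  thus ?thesis using cong_mult_lcancel_nat[OF cop] by blast
qed

text \<open>Multiplying the two representations gives \<open>16 p\<^sup>2\<^sup>k = (A C + 27 B D)\<^sup>2 + 27 (A D - B C)\<^sup>2\<close>.
  After a choice of the sign of \<open>B\<close>, \<open>p ^ k\<close> divides \<open>A D - B C\<close>, which is therefore \<open>0\<close>.\<close>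

lemma norm_form_unique:
  fixes p A B C D :: int
  assumes "prime p" "p \<noteq> 2"
    and AB: "A ^ 2 + 27 * B ^ 2 = 4 * p ^ k" and CD: "C ^ 2 + 27 * D ^ 2 = 4 * p ^ k"
    and "\<not> p dvd A" "\<not> p dvd C" and mod3: "A mod 3 = 1" "C mod 3 = 1"
  shows "A = C"
proof -
  have p0: "p ^ k > 0" using assms(1) prime_gt_0_int by simp
  have *: "A ^ 2 = C ^ 2" if AB: "A ^ 2 + 27 * B ^ 2 = 4 * p ^ k" and "p ^ k dvd A * D - B * C" for B
  proof -
    obtain t where t: "A * D - B * C = p ^ k * t" using \<open>p ^ k dvd _\<close> by (auto elim: dvdE)
    have "(A * C + 27 * (B * D)) ^ 2 + 27 * (A * D - B * C) ^ 2 =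
      (A ^ 2 + 27 * B ^ 2) * (C ^ 2 + 27 * D ^ 2)"
      by (simp add: power2_eq_square algebra_simps)
    hence "27 * (p ^ k * t) ^ 2 \<le> 16 * (p ^ k) ^ 2"
      unfolding t AB CD by (simp add: power2_eq_square) (smt (verit) zero_le_square)
    hence "(27 * t ^ 2) * (p ^ k) ^ 2 \<le> 16 * (p ^ k) ^ 2" by (simp add: power_mult_distrib mult_ac)
    hence "27 * t ^ 2 \<le> 16"
      by (rule mult_right_le_imp_le) (use zero_less_power[OF p0, of 2] in simp)
    hence "t = 0" by (smt (verit) zero_less_power2)
    hence X: "A * D = B * C" using t by simp
    have "A ^ 2 * (C ^ 2 + 27 * D ^ 2) = A ^ 2 * C ^ 2 + 27 * (A * D) ^ 2"
      by (simp add: power2_eq_square algebra_simps)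
    also have "\<dots> = C ^ 2 * (A ^ 2 + 27 * B ^ 2)"
      unfolding X by (simp add: power2_eq_square algebra_simps)
    finally show "A ^ 2 = C ^ 2" 
      unfolding AB CD using p0 assms(1) by auto
  qed
  have prod: "(A * D - B * C) * (A * D + B * C) = p ^ k * (4 * (D ^ 2 - B ^ 2))"
  proof -
    have "(A * D - B * C) * (A * D + B * C) = A ^ 2 * D ^ 2 - B ^ 2 * C ^ 2"
      by (simp add: power2_eq_square algebra_simps)
    also have "\<dots> = (4 * p ^ k - 27 * B ^ 2) * D ^ 2 - B ^ 2 * (4 * p ^ k - 27 * D ^ 2)"
    proof -
      have "A ^ 2 = 4 * p ^ k - 27 * B ^ 2" "C ^ 2 = 4 * p ^ k - 27 * D ^ 2" using AB CD by linarith+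
      thus ?thesis by (simp only:)
    qed
    finally show ?thesis by (simp add: algebra_simps)
  qed
  have "p ^ k dvd A * D - B * C \<or> p ^ k dvd A * D + B * C"
  proof (cases "k = 0")
    case False
    \<comment> \<open>A common divisor \<open>p\<close> would divide the sum
      \<open>2 * (A * D)\<close>, hence \<open>D\<close>, hence \<open>C\<close>. So one factor is
      prime to \<open>p\<close> and the other absorbs all of \<open>p ^ k\<close>.\<close>
    have "\<not> (p dvd A * D - B * C \<and> p dvd A * D + B * C)"
    proof
      assume "p dvd A * D - B * C \<and> p dvd A * D + B * C"
      hence "p dvd (A * D - B * C) + (A * D + B * C)" by (blast intro: dvd_add)
      also have "(A * D - B * C) + (A * D + B * C) = 2 * (A * D)" by simp
      finally have "p dvd 2 * (A * D)" .
      moreover have "\<not> p dvd 2" using assms(1,2) primes_dvd_imp_eq[of p 2] by auto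
      ultimately have "p dvd D" using assms(1,5) by (auto simp: prime_dvd_mult_iff)
      hence "p dvd 4 * p ^ k - 27 * D ^ 2"
        using False by (intro dvd_diff) (auto simp: power2_eq_square)
      also have "4 * p ^ k - 27 * D ^ 2 = C ^ 2" using CD by linarith
      finally have "p dvd C ^ 2" .
      thus False using assms(1,6) prime_dvd_power by blast
    qed
    hence "coprime (p ^ k) (A * D - B * C) \<or> coprime (p ^ k) (A * D + B * C)"
      using assms(1) prime_imp_coprime by (auto simp: coprime_power_left_iff)
    moreover have "p ^ k dvd (A * D - B * C) * (A * D + B * C)" by (simp add: prod)
    ultimately show ?thesis
      by (auto simp: coprime_dvd_mult_right_iff coprime_dvd_mult_left_iff)
  qed simp
  \<comment> \<open>The second alternative is the first with \<open>- B\<close> in place of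
    \<open>B\<close>.\<close>
  hence "A ^ 2 = C ^ 2"
    using *[of B] *[of "- B"] AB by auto
  hence "A = C \<or> A = - C" by (simp add: power2_eq_iff)
  thus ?thesis using mod3 by presburger
qed

section \<open>Primes that are inert in the Eisenstein integers\<close>

text \<open>For \<open>p = 3 * t + 2\<close>, Fermat gives \<open>x * (x ^ 3) ^ t = 1\<close> modulo
  \<open>p\<close> for \<open>x\<close> prime to \<open>p\<close>, so the cube of \<open>x\<close>
  determines \<open>x\<close>.\<close>

lemma cube_cong_imp_cong:
  fixes a b :: int
  assumes "prime (p::nat)" "p mod 3 = 2" "[a ^ 3 = b ^ 3] (mod p)" "\<not> int p dvd b"
  shows "[a = b] (mod p)"
proof -
  have pp: "prime (int p)" using assms(1) by simp
  have "\<not> int p dvd a"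
  proof
    assume "int p dvd a"
    hence "int p dvd a ^ 3" by (simp add: power3_eq_cube)
    hence "int p dvd b ^ 3" using assms(3) cong_dvd_iff by blast
    thus False using assms(4) pp prime_dvd_power by blast
  qed
  have fermat: "[x ^ (p - 1) = 1] (mod p)" if "\<not> int p dvd x" for x :: int
  proof -
    have x: "[int (nat (x mod p)) = x] (mod p)" using assms(1) prime_gt_0_nat by (simp add: cong_def)
    hence "\<not> p dvd nat (x mod p)" using that cong_dvd_iff by (metis int_dvd_int_iff)
    hence "[nat (x mod p) ^ (p - 1) = 1] (mod p)" by (rule fermat_theorem[OF assms(1)])
    hence "[int (nat (x mod p)) ^ (p - 1) = 1] (mod p)"
      by (metis cong_int_iff of_nat_1 of_nat_power)
    thus ?thesis using cong_pow[OF x, of "p - 1"] cong_sym cong_trans by blast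
  qed
  define t where "t = p div 3"
  have t: "p = 3 * t + 2" using assms(2) unfolding t_def by presburger
  have "[(a ^ 3) ^ t = (b ^ 3) ^ t] (mod p)" by (intro cong_pow assms)
  hence eq: "[a ^ (3 * t) = b ^ (3 * t)] (mod p)" by (simp add: power_mult)
  have "[a * 1 = a * b ^ (p - 1)] (mod p)"
    using fermat[OF assms(4)] by (intro cong_mult cong_refl) (simp add: cong_sym)
  also have "a * b ^ (p - 1) = a * b ^ (3 * t) * b" using t by simp
  also have "[\<dots> = a * a ^ (3 * t) * b] (mod p)"
    using eq by (intro cong_mult cong_refl) (simp add: cong_sym)
  also have "a * a ^ (3 * t) * b = a ^ (p - 1) * b" using t by simp
  also have "[\<dots> = 1 * b] (mod p)"
    using fermat[OF \<open>\<not> int p dvd a\<close>] by (intro cong_mult cong_refl)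
  finally show ?thesis by simp
qed

text \<open>With \<open>a = A - 3 * B\<close> and \<open>b = 3 * B\<close> the form is the cofactor
  of \<open>a - 2 * b\<close> in \<open>a ^ 3 - (2 * b) ^ 3\<close>. So the cubes agree modulo
  \<open>p\<close>, then \<open>a\<close> and \<open>2 * b\<close> do, and the form reduces to
  \<open>3 * (2 * b) ^ 2\<close>.\<close>

lemma inert_prime_dvd_norm_form:
  fixes A B :: int
  assumes "prime (p::nat)" "p mod 3 = 2" "p \<noteq> 2" "int p dvd A ^ 2 + 27 * B ^ 2"
  shows "int p dvd B"
proof (rule ccontr)
  assume nB: "\<not> int p dvd B"
  have pp: "prime (int p)" using assms(1) by simp
  have p23: "\<not> int p dvd 2" "\<not> int p dvd 3"
    using pp assms(2,3) primes_dvd_imp_eq[of "int p" 2] primes_dvd_imp_eq[of "int p" 3] by auto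
  define b where "b = 3 * B"
  define a where "a = A - b"
  have nb: "\<not> int p dvd 2 * b" 
    using nB p23 unfolding b_def prime_dvd_mult_iff[OF pp] by blast
  have N: "A ^ 2 + 27 * B ^ 2 = a ^ 2 + a * (2 * b) + (2 * b) ^ 2"
    by (simp add: a_def b_def power2_eq_square algebra_simps)
  have "a ^ 3 - (2 * b) ^ 3 = (a - 2 * b) * (A ^ 2 + 27 * B ^ 2)"
    unfolding N by (simp add: power2_eq_square power3_eq_cube algebra_simps)
  hence "[a ^ 3 = (2 * b) ^ 3] (mod p)" using assms(4) by (simp add: cong_iff_dvd_diff)
  hence c: "[a = 2 * b] (mod p)" using cube_cong_imp_cong assms(1,2) nb by blast
  have "[a ^ 2 + a * (2 * b) + (2 * b) ^ 2 = (2 * b) ^ 2 + (2 * b) * (2 * b) + (2 * b) ^ 2] (mod p)"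
    by (intro cong_add cong_mult cong_pow c cong_refl)
  hence "int p dvd (2 * b) ^ 2 + (2 * b) * (2 * b) + (2 * b) ^ 2"
    using assms(4) N cong_dvd_iff by metis
  also have "(2 * b) ^ 2 + (2 * b) * (2 * b) + (2 * b) ^ 2 = 3 * ((2 * b) * (2 * b))"
    by (simp add: power2_eq_square)
  finally show False using nb p23 unfolding prime_dvd_mult_iff[OF pp] by blast
qed

text \<open>Descent: \<open>p\<close> divides both \<open>A\<close> and \<open>B\<close> and is
  cancelled. As \<open>p\<close> is -1 modulo 3, the quotient must change sign to keep residue 1,
  which builds up \<open>(- int p) ^ j\<close>; at \<open>j = 0\<close> only \<open>A = - 2\<close>
  is left.\<close>

lemma norm_form_inert:
  fixes A B :: int
  assumes "prime (p::nat)" "p mod 3 = 2"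
    and "A ^ 2 + 27 * B ^ 2 = 4 * int p ^ (2 * j)" "A mod 3 = 1"
  shows "A = - 2 * (- int p) ^ j"
  using assms(3,4)
proof (induction j arbitrary: A B)
  case 0
  hence eq: "A ^ 2 + 27 * B ^ 2 = 4" by simp
  have "B = 0"
  proof (rule ccontr)
    assume "B \<noteq> 0"
    hence "B ^ 2 > 0" by simp
    thus False using eq zero_le_power2[of A] by linarith
  qed
  hence "A ^ 2 = 2 ^ 2" using eq by simp
  hence "A = 2 \<or> A = - 2" by (simp only: power2_eq_iff)
  thus ?case using 0 by auto
next
  case (Suc j)
  have pp: "prime (int p)" using assms(1) by simp
  have eq: "A ^ 2 + 27 * B ^ 2 = (int p) ^ 2 * (4 * int p ^ (2 * j))"
    using Suc.prems(1) by (simp add: power2_eq_square)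
  have "int p dvd A \<and> int p dvd B"
  proof (cases "p = 2")
    case True
    have eq2: "A ^ 2 + 27 * B ^ 2 = 16 * 2 ^ (2 * j)" using eq True by simp
    hence "even (A ^ 2 + 27 * B ^ 2)" by simp
    hence par: "even A \<longleftrightarrow> even B" by simp
    have "even A"
    proof (rule ccontr)
      assume "odd A"
      then obtain a b where ab: "A = 2 * a + 1" "B = 2 * b + 1" using par by (metis oddE)
      \<comment> \<open>For odd \<open>A\<close> and \<open>B\<close> a quarter of the form is odd,
        whereas a quarter of the right-hand side is still even.\<close>
      have "A ^ 2 + 27 * B ^ 2 = 4 * (a * (a + 1) + 27 * (b * (b + 1)) + 7)"
        by (simp add: ab power2_eq_square algebra_simps)
      hence "a * (a + 1) + 27 * (b * (b + 1)) + 7 = 4 * 2 ^ (2 * j)" using eq2 by simp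
      moreover have "even (a * (a + 1))" "even (b * (b + 1))" by simp_all
      ultimately show False by (metis even_add even_mult_iff even_numeral odd_numeral)
    qed
    thus ?thesis using par True by simp
  next
    case False
    have "int p dvd A ^ 2 + 27 * B ^ 2" unfolding eq by (simp add: power2_eq_square)
    hence "int p dvd B" using inert_prime_dvd_norm_form assms False by blast
    hence "int p dvd (A ^ 2 + 27 * B ^ 2) - 27 * B ^ 2"
      using \<open>int p dvd A ^ 2 + 27 * B ^ 2\<close> by (intro dvd_diff) (auto simp: power2_eq_square)
    hence "int p dvd A ^ 2" by simp
    thus ?thesis using \<open>int p dvd B\<close> pp prime_dvd_power by blast
  qed
  then obtain A' B' where AB: "A = int p * A'" "B = int p * B'" by (auto elim!: dvdE)
  have "(int p) ^ 2 * (A' ^ 2 + 27 * B' ^ 2) = (int p) ^ 2 * (4 * int p ^ (2 * j))"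
    using eq by (simp add: AB power_mult_distrib algebra_simps)
  moreover have "int p \<noteq> 0" using assms(1) prime_gt_0_nat by simp
  ultimately have "(- A') ^ 2 + 27 * B' ^ 2 = 4 * int p ^ (2 * j)" by simp
  moreover have "(- A') mod 3 = 1"
  proof -
    define t where "t = int (p div 3)"
    have "int p = 3 * t + 2" using assms(2) unfolding t_def by presburger
    hence "A = 3 * (t * A') + 2 * A'" by (simp add: AB algebra_simps)
    thus ?thesis using Suc.prems(2) by presburger
  qed
  ultimately have "- A' = - 2 * (- int p) ^ j" by (rule Suc.IH)
  hence "A' = 2 * (- int p) ^ j" by simp
  thus ?case by (simp add: AB)
qed

section \<open>Powers of an element of norm \<open>p\<close>\<close>

text \<open>A Lucas sequence: with \<open>a = A\<close> and \<open>b = p\<close> it tracks the real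
  or imaginary parts of powers of a root of \<open>X ^ 2 + A * X + p\<close>, scaled to
  integers.\<close>

fun linrec :: "int \<Rightarrow> int \<Rightarrow> int \<Rightarrow> int \<Rightarrow> nat \<Rightarrow> int" where
  "linrec a b x y 0 = x"
| "linrec a b x y (Suc 0) = y"
| "linrec a b x y (Suc (Suc k)) = - a * linrec a b x y (Suc k) - b * linrec a b x y k"

text \<open>The norm equation is multiplicativity of the absolute value. Modulo 3 the recurrence
  sends residues 1 and 1 to \<open>- 1 - 1\<close>, which is again 1; modulo \<open>p\<close>, from
  \<open>A\<close> on, each step multiplies by \<open>- A\<close>.\<close>

lemma power_sum_norm_form:
  fixes z :: complex and A B :: int and p k :: nat
  assumes z: "Re z = - real_of_int A / 2" "Im z = 3 * sqrt 3 / 2 * real_of_int B"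
    and AB: "A ^ 2 + 27 * B ^ 2 = 4 * int p" and "A mod 3 = 1" and "p mod 3 = 1"
    and "prime p" and "\<not> int p dvd A" and "k > 0"
  obtains C D :: int where "z ^ k + cnj z ^ k = - of_int C" "C ^ 2 + 27 * D ^ 2 = 4 * int p ^ k"
    "C mod 3 = 1" "\<not> int p dvd C"
proof -
  define C where "C = linrec A (int p) (- 2) A"
  define D where "D = linrec A (int p) 0 B"
  have "real_of_int (A ^ 2 + 27 * B ^ 2) = real_of_int (4 * int p)" using AB by simp
  hence p: "real p = (real_of_int A ^ 2 + 27 * real_of_int B ^ 2) / 4" by simp
  have zz: "z * z = - of_int A * z - of_nat p"
    by (rule complex_eqI) (simp_all add: z p power2_eq_square field_simps)
  have rec: "z ^ Suc (Suc k) = - of_int A * z ^ Suc k - of_nat p * z ^ k" for k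
  proof -
    have "z ^ Suc (Suc k) = (z * z) * z ^ k" by simp
    thus ?thesis by (simp only: zz) (simp add: algebra_simps)
  qed
  have re: "2 * Re (z ^ k) = - real_of_int (C k)" for k
  \<comment> \<open>\<open>linrec.induct\<close> serves as two-step induction on \<open>k\<close>;
    its other four arguments are dummies.\<close>
  proof (induction k rule: linrec.induct[of "\<lambda>_ _ _ _ k. 2 * Re (z ^ k) = - real_of_int (C k)" 0 0 0 0])
    case (3 a b x y k)
    have "2 * Re (z ^ Suc (Suc k)) = - real_of_int A * (2 * Re (z ^ Suc k)) - real p * (2 * Re (z ^ k))"
      by (simp only: rec) simp
    thus ?case by (simp only: 3) (simp add: C_def)
  qed (simp_all add: C_def z)
  have im: "2 * Im (z ^ k) = 3 * sqrt 3 * real_of_int (D k)" for k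
  proof (induction k rule: linrec.induct[of "\<lambda>_ _ _ _ k. 2 * Im (z ^ k) = 3 * sqrt 3 * real_of_int (D k)" 0 0 0 0])
    case (3 a b x y k)
    have "2 * Im (z ^ Suc (Suc k)) = - real_of_int A * (2 * Im (z ^ Suc k)) - real p * (2 * Im (z ^ k))"
      by (simp only: rec) simp
    thus ?case by (simp only: 3) (simp add: D_def algebra_simps)
  qed (simp_all add: D_def z)
  have "z ^ k + cnj z ^ k = - of_int (C k)"
    using re[of k] by (simp add: complex_add_cnj flip: complex_cnj_power)
  moreover have "C k ^ 2 + 27 * D k ^ 2 = 4 * int p ^ k"
  proof -
    have "(cmod z) ^ 2 = real p"
      by (simp add: cmod_power2 z p power_mult_distrib power_divide field_simps)
    hence "real p ^ k = (cmod (z ^ k)) ^ 2"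
      by (metis norm_power power_mult mult.commute)
    also have "\<dots> = (Re (z ^ k)) ^ 2 + (Im (z ^ k)) ^ 2" by (rule cmod_power2)
    finally have "4 * real p ^ k = (2 * Re (z ^ k)) ^ 2 + (2 * Im (z ^ k)) ^ 2" by simp
    hence "4 * real p ^ k = real_of_int (C k ^ 2 + 27 * D k ^ 2)"
      unfolding re im by (simp add: power_mult_distrib)
    hence "real_of_int (4 * int p ^ k) = real_of_int (C k ^ 2 + 27 * D k ^ 2)" by simp
    thus ?thesis by (simp only: of_int_eq_iff)
  qed
  moreover have "C k mod 3 = 1" for k
  proof (induction k rule: linrec.induct[of "\<lambda>_ _ _ _ k. C k mod 3 = 1" 0 0 0 0])
    case (3 a b x y k)
    define t where "t = A div 3"
    have A: "A = 3 * t + 1" using \<open>A mod 3 = 1\<close> unfolding t_def by presburger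
    define u where "u = int (p div 3)"
    have p: "int p = 3 * u + 1" using \<open>p mod 3 = 1\<close> unfolding u_def by presburger
    have "C (Suc (Suc k)) = 3 * (- t * C (Suc k) - u * C k) - C (Suc k) - C k"
      by (simp add: C_def A p algebra_simps)
    thus ?case using 3 by presburger
  qed (use \<open>A mod 3 = 1\<close> in \<open>simp_all add: C_def\<close>)
  moreover have "\<not> int p dvd C (Suc k)" for k
  proof (induction k)
    case 0
    thus ?case using \<open>\<not> int p dvd A\<close> by (simp add: C_def)
  next
    case (Suc k)
    show ?case
    proof
      assume "int p dvd C (Suc (Suc k))"
      hence "int p dvd C (Suc (Suc k)) + int p * C k" by simp
      hence "int p dvd A * C (Suc k)" by (simp add: C_def)
      thus False using Suc.IH \<open>\<not> int p dvd A\<close> \<open>prime p\<close> by (simp add: prime_dvd_mult_iff)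
    qed
  qed
  ultimately show ?thesis using that[of "C k" "D k"] \<open>k > 0\<close> by (metis Suc_pred)
qed

section \<open>Identification of \<open>kappa p\<close>\<close>

lemma abs_le_of_square_less:
  fixes x b :: int
  assumes "x ^ 2 < (b + 1) ^ 2" "b \<ge> 0"
  shows "\<bar>x\<bar> \<le> b"
  using assms power2_le_imp_le abs_le_square_iff[of "b + 1" x] by (smt (verit))

text \<open>Integers bounded by \<open>2 * sqrt p\<close> that agree modulo \<open>p\<close> differ
  by at most \<open>4 * sqrt p\<close>, which is below \<open>p\<close> once \<open>p > 16\<close>.
  The smaller primes that are 1 modulo 3, namely 7 and 13, are settled by enumeration.\<close>

lemma kappa_eqI:
  fixes A B :: int
  assumes "prime p" "p mod 3 = 1"
    and AB: "A ^ 2 + 27 * B ^ 2 = 4 * int p" and A3: "A mod 3 = 1"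
    and cong: "[A = - int ((2 * ((p - 1) div 3)) choose ((p - 1) div 3))] (mod p)"
  shows "kappa p = A"
proof -
  consider "p = 7" | "p = 13" | "p \<ge> 19"
  proof -
    have "p \<noteq> 4" "p \<noteq> 10" "p \<noteq> 16" "p \<noteq> 1"
    proof -
      have "even p \<Longrightarrow> p = 2" using assms(1) primes_dvd_imp_eq[of 2 p] two_is_prime_nat by metis
      thus "p \<noteq> 4" "p \<noteq> 10" "p \<noteq> 16" by auto
      show "p \<noteq> 1" using assms(1) by auto
    qed
    hence "p = 7 \<or> p = 13 \<or> p \<ge> 19" using assms(2) by presburger
    thus ?thesis using that by blast
  qed
  thus ?thesis
  proof cases
    case 1
    \<comment> \<open>Up to signs \<open>28 = 1 ^ 2 + 27\<close> is the only representation; the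
      residue modulo 3 selects \<open>A = 1\<close>.\<close>
    have "A ^ 2 < 36" "B ^ 2 < 4"
      using AB 1 zero_le_power2[of A] zero_le_power2[of B] by linarith+
    hence "\<bar>A\<bar> \<le> 5" "\<bar>B\<bar> \<le> 1"
      using abs_le_of_square_less[of A 5] abs_le_of_square_less[of B 1] by simp_all
    hence "A \<in> {-5, -2, 1, 4}" "B \<in> {-1, 0, 1}" using A3 by (simp, presburger)+
    hence "A = 1" using AB 1 by auto
    thus ?thesis using 1 by (simp add: kappa_def)
  next
    case 2
    \<comment> \<open>Here \<open>52 = 5 ^ 2 + 27\<close>, and \<open>- 5\<close> is the choice with
      residue 1 modulo 3.\<close>
    have "A ^ 2 < 64" "B ^ 2 < 4"
      using AB 2 zero_le_power2[of A] zero_le_power2[of B] by linarith+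
    hence "\<bar>A\<bar> \<le> 7" "\<bar>B\<bar> \<le> 1"
      using abs_le_of_square_less[of A 7] abs_le_of_square_less[of B 1] by simp_all
    hence "A \<in> {-5, -2, 1, 4, 7}" "B \<in> {-1, 0, 1}" using A3 by (simp, presburger)+
    hence "A = - 5" using AB 2 by auto
    thus ?thesis using 2 by (simp add: kappa_def)
  next
    case 3
    define m where "m = (p - 1) div 6"
    have "odd p" using assms(1) 3 prime_odd_nat by force
    hence p: "p = 6 * m + 1" using assms(2) unfolding m_def by presburger
    have divs: "(p - 1) div 2 = 3 * m" "(p - 1) div 3 = 2 * m" "(p - 1) div 6 = m"
      using p by auto
    have double: "2 * (2 * m) = 4 * m" by simp
    have sqrt: "2 * sqrt (real p) = sqrt (real (4 * p))" by (simp add: real_sqrt_mult)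
    let ?P = "\<lambda>k::int. \<bar>real_of_int k\<bar> \<le> 2 * sqrt (real p) \<and>
           [k * 4 ^ m = - int ((3 * m) choose (2 * m))] (mod int p)"
    have bound: "k ^ 2 \<le> 4 * int p" if "?P k" for k
    proof -
      have "\<bar>real_of_int k\<bar> ^ 2 \<le> (2 * sqrt (real p)) ^ 2"
        using that by (intro power_mono) auto
      hence "real_of_int (k ^ 2) \<le> real_of_int (4 * int p)" by (simp add: power_mult_distrib)
      thus ?thesis by (simp only: of_int_le_iff)
    qed
    have "?P A"
    proof
      have "A ^ 2 \<le> 4 * int p" using AB zero_le_power2[of B] by linarith
      hence "real_of_int (A ^ 2) \<le> real_of_int (4 * int p)" by (simp only: of_int_le_iff)
      hence "sqrt ((real_of_int A) ^ 2) \<le> sqrt (real (4 * p))"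
        by (intro real_sqrt_le_mono) simp
      thus "\<bar>real_of_int A\<bar> \<le> 2 * sqrt (real p)" unfolding sqrt real_sqrt_abs .
      have "[A * 4 ^ m = - int ((4 * m) choose (2 * m)) * 4 ^ m] (mod int p)"
        using cong double by (intro cong_mult cong_refl) (simp only: divs)
      also have "- int ((4 * m) choose (2 * m)) * 4 ^ m = - int (4 ^ m * ((4 * m) choose (2 * m)))"
        by simp
      also have "[\<dots> = - int ((3 * m) choose (2 * m))] (mod int p)"
        using middle_choose_cong[of m] assms(1) p by (simp only: cong_minus_minus_iff cong_int_iff)
      finally show "[A * 4 ^ m = - int ((3 * m) choose (2 * m))] (mod int p)" .
    qed
    moreover have "k = A" if "?P k" for k
    proof -
      have "[k * 4 ^ m = A * 4 ^ m] (mod int p)"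
        using that \<open>?P A\<close> cong_sym cong_trans by blast
      moreover have "coprime (4 ^ m :: int) (int p)"
      proof -
        have "coprime 2 p" using \<open>odd p\<close> by simp
        hence "coprime (2 ^ 2) (int p)" by (metis coprime_int_iff coprime_power_left_iff of_nat_numeral)
        thus ?thesis by (simp add: coprime_power_left_iff)
      qed
      ultimately have "[k = A] (mod int p)" using cong_mult_rcancel by blast
      hence dvd: "int p dvd k - A" by (simp add: cong_iff_dvd_diff)
      have "(k - A) ^ 2 \<le> 2 * k ^ 2 + 2 * A ^ 2"
        using zero_le_power2[of "k + A"] by (simp add: power2_eq_square algebra_simps)
      also have "\<dots> \<le> 16 * int p" using bound[OF that] bound[OF \<open>?P A\<close>] by linarith
      also have "\<dots> < (int p) ^ 2" using 3 by (simp add: power2_eq_square)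
      finally have "\<bar>k - A\<bar> < int p" using power2_less_imp_less[of "\<bar>k - A\<bar>" "int p"] by simp
      thus ?thesis using dvd dvd_imp_le_int[of "k - A" "int p"] by force
    qed
    ultimately have "(THE k. ?P k) = A" by (rule the_equality)
    moreover have "kappa p = (THE k. ?P k)"
      using 3 assms(2) unfolding kappa_def divs by simp
    ultimately show ?thesis by simp
  qed
qed

section \<open>The trace of the field in terms of the prime field\<close>

lemma finite_subfield_UNIV: "finite_subfield (UNIV :: 'a::{finite,field} set)"
  by unfold_locales auto

lemma finite_subfield_range_of_int:
  fixes p :: nat
  assumes "CHAR('a::field) = p" "p > 0"
  shows "finite_subfield (range (of_int :: int \<Rightarrow> 'a))" "card (range (of_int :: int \<Rightarrow> 'a)) = p"
proof -
  have eq_iff: "(of_int x :: 'a) = of_int y \<longleftrightarrow> x mod int p = y mod int p" for x y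
    using of_int_eq_iff_cong_CHAR[where ?'a = 'a, of x y] assms by (simp add: cong_def)
  have "range (of_int :: int \<Rightarrow> 'a) = of_int ` {0..<int p}"
  proof (intro equalityI subsetI)
    fix y :: 'a assume "y \<in> range of_int"
    then obtain x where "y = of_int x" by blast
    hence "y = of_int (x mod int p)" by (simp add: eq_iff)
    thus "y \<in> of_int ` {0..<int p}" using assms by auto
  qed auto
  moreover have "inj_on (of_int :: int \<Rightarrow> 'a) {0..<int p}"
    by (auto intro!: inj_onI simp: eq_iff)
  ultimately show card: "card (range (of_int :: int \<Rightarrow> 'a)) = p" by (simp add: card_image)
  show "finite_subfield (range (of_int :: int \<Rightarrow> 'a))"
  proof
    show "finite (range (of_int :: int \<Rightarrow> 'a))"
      using card assms by (metis card.infinite less_numeral_extra(3))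
    show "(1::'a) \<in> range of_int" by (metis of_int_1 rangeI)
    show "x - y \<in> range of_int" if "x \<in> range of_int" "y \<in> range of_int" for x y :: 'a
      using that by (auto simp flip: of_int_diff)
    show "x * y \<in> range of_int" if "x \<in> range of_int" "y \<in> range of_int" for x y :: 'a
      using that by (auto simp flip: of_int_mult)
  qed
qed

lemma (in cubic_subfield) trace_cong:
  "[trace = - int ((2 * s) choose s)] (mod CHAR('a))"
proof -
  have "(of_int (trace + int ((2 * s) choose s)) :: 'a) = 0" by (simp add: of_int_trace)
  hence "int CHAR('a) dvd trace - (- int ((2 * s) choose s))"
    unfolding of_int_eq_0_iff_char_dvd by simp
  thus ?thesis by (simp only: cong_iff_dvd_diff)
qed

lemma (in finite_subfield) cubic_subfield_ex:
  assumes "card K mod 3 = 1"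
  obtains w where "cubic_subfield K w"
  using ex_primitive_cube_root[OF assms] assms
  by (metis cubic_subfield_axioms_def cubic_subfield_def finite_subfield_axioms)

lemma pi_p_power_sum:
  fixes w :: "'a::{finite,field}"
  assumes "prime p" "k > 0" "card (UNIV :: 'a set) = p ^ k" "p ^ k mod 3 = 1"
    and w: "cubic_subfield (UNIV :: 'a set) w"
  shows "pi_p p ^ k + cnj (pi_p p) ^ k = - of_int (cubic_subfield.trace (UNIV :: 'a set))"
proof -
  interpret F: cubic_subfield "UNIV :: 'a set" w by (rule w)
  have "CHAR('a) dvd p ^ k" using CHAR_dvd_CARD[where ?'a = 'a] assms by simp
  moreover have "prime CHAR('a)"
    using prime_CHAR_semidom[where ?'a = 'a] finite_imp_CHAR_pos[where ?'a = 'a] by simp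
  ultimately have char: "CHAR('a) = p"
    using assms(1) by (metis prime_dvd_power primes_dvd_imp_eq)
  have norm: "F.trace ^ 2 + 27 * (int F.d1 - int F.d2) ^ 2 = 4 * int p ^ k"
    using F.trace_norm assms(3) by simp
  have "p mod 3 = 1 \<or> p mod 3 = 2"
  proof -
    have "p mod 3 \<noteq> 0"
    proof
      assume "p mod 3 = 0"
      hence "3 dvd p" by (rule mod_0_imp_dvd)
      hence "3 dvd p ^ k" using assms(2) by (metis dvd_trans dvd_power)
      thus False using assms(4) by (simp add: dvd_eq_mod_eq_0)
    qed
    thus ?thesis by presburger
  qed
  thus ?thesis
  proof
    assume p1: "p mod 3 = 1"
    \<comment> \<open>The prime field inside \<open>'a\<close> supplies the representation of
      \<open>4 * p\<close> from which \<open>kappa p\<close> is read off.\<close>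
    interpret P: finite_subfield "range (of_int :: int \<Rightarrow> 'a)"
      by (rule finite_subfield_range_of_int(1)[OF char prime_gt_0_nat[OF assms(1)]])
    have cardP: "card (range (of_int :: int \<Rightarrow> 'a)) = p"
      by (rule finite_subfield_range_of_int(2)[OF char prime_gt_0_nat[OF assms(1)]])
    obtain v :: 'a where "cubic_subfield (range of_int) v"
      using P.cubic_subfield_ex cardP p1 by blast
    then interpret P: cubic_subfield "range (of_int :: int \<Rightarrow> 'a)" v .
    have normP: "P.trace ^ 2 + 27 * (int P.d1 - int P.d2) ^ 2 = 4 * int p"
      using P.trace_norm cardP by simp
    have cong: "[P.trace = - int ((2 * ((p - 1) div 3)) choose ((p - 1) div 3))] (mod p)"
      using P.trace_cong by (simp only: char P.s_def cardP)
    have congF: "[F.trace = - int ((2 * ((p ^ k - 1) div 3)) choose ((p ^ k - 1) div 3))] (mod p)"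
      using F.trace_cong by (simp only: char F.s_def assms(3))
    have ndvd: "\<not> int p dvd P.trace" "\<not> int p dvd F.trace"
      using prime_not_dvd_middle_choose[OF assms(1) p1, of 1] cong_dvd_iff[OF cong]
        prime_not_dvd_middle_choose[OF assms(1) p1, of k] cong_dvd_iff[OF congF] by simp_all
    have kappa: "kappa p = P.trace"
      using kappa_eqI[OF assms(1) p1 normP P.trace_mod_3 cong] .
    \<comment> \<open>\<open>pi_p\<close> takes the nonnegative square root, so the sign of
      \<open>d1 - d2\<close> is dropped.\<close>
    define B where "B = \<bar>int P.d1 - int P.d2\<bar>"
    have normB: "P.trace ^ 2 + 27 * B ^ 2 = 4 * int p" using normP by (simp add: B_def)
    have "real_of_int (P.trace ^ 2 + 27 * B ^ 2) = real_of_int (4 * int p)" using normB by (simp only:)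
    hence "real p - (real_of_int P.trace) ^ 2 / 4 = (3 * sqrt 3 / 2 * real_of_int B) ^ 2"
      by (simp add: power_mult_distrib power_divide)
    moreover have "B \<ge> 0" by (simp add: B_def)
    ultimately have im: "Im (pi_p p) = 3 * sqrt 3 / 2 * real_of_int B"
      by (simp add: pi_p_def kappa)
    have re: "Re (pi_p p) = - real_of_int P.trace / 2" by (simp add: pi_p_def kappa)
    obtain C D where CD: "pi_p p ^ k + cnj (pi_p p) ^ k = - of_int C"
      "C ^ 2 + 27 * D ^ 2 = 4 * int p ^ k" "C mod 3 = 1" "\<not> int p dvd C"
      using power_sum_norm_form[OF re im normB P.trace_mod_3 p1 assms(1) ndvd(1) assms(2)] .
    \<comment> \<open>Both occur in representations of \<open>4 * p ^ k\<close>, are prime to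
      \<open>p\<close> and are 1 modulo 3, so uniqueness applies.\<close>
    have "F.trace = C"
    proof (rule norm_form_unique[OF _ _ norm CD(2)])
      show "int p \<noteq> 2" using p1 by auto
    qed (use assms(1) ndvd CD F.trace_mod_3 in auto)
    thus ?thesis using CD by simp
  next
    assume p2: "p mod 3 = 2"
    \<comment> \<open>As \<open>p\<close> is -1 modulo 3, an odd power of it is not 1 modulo
      3.\<close>
    have "even k"
    proof (rule ccontr)
      assume "odd k"
      then obtain j where "k = 2 * j + 1" by (rule oddE)
      hence "p ^ k = (p ^ 2) ^ j * p" by (simp add: power_mult)
      moreover have "(p ^ 2) ^ j mod 3 = 1"
      proof -
        have "p ^ 2 mod 3 = 1" using power_mod[of p 3 2] p2 by simp
        thus ?thesis using power_mod[of "p ^ 2" 3 j] by simp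
      qed
      ultimately have "p ^ k mod 3 = 2" using p2 mod_mult_eq[of "(p ^ 2) ^ j" 3 p] by simp
      thus False using assms(4) by simp
    qed
    then obtain j where k: "k = 2 * j" by (rule evenE)
    have trace: "F.trace = - 2 * (- int p) ^ j"
      using norm_form_inert[OF assms(1) p2 _ F.trace_mod_3] norm k by blast
    \<comment> \<open>Now \<open>pi_p p\<close> is purely imaginary with square \<open>- p\<close>,
      so both \<open>k\<close>-th powers equal \<open>(- p) ^ j\<close>.\<close>
    have "kappa p = 0" using p2 by (auto simp: kappa_def)
    hence pi: "pi_p p = \<i> * complex_of_real (sqrt (real p))"
      by (simp add: pi_p_def complex_eq_iff)
    have sq: "complex_of_real (sqrt (real p)) ^ 2 = of_nat p"
      by (simp flip: of_real_power)
    have "pi_p p ^ 2 = - of_nat p" "cnj (pi_p p) ^ 2 = - of_nat p"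
      by (simp_all add: pi power_mult_distrib sq)
    hence "pi_p p ^ k + cnj (pi_p p) ^ k = 2 * (- of_nat p) ^ j" by (simp add: k power_mult)
    thus ?thesis by (simp add: trace)
  qed
qed

theorem theorem4p5:
  fixes p k n q :: nat
    and e1 e2 :: int
  assumes "prime p" and "k > 0" and "q = p ^ k"
    and "card (UNIV :: 'a::{finite,field} set) = q"
    and "q mod 3 = 1"
    and "n > 0" and "gcd n ((q - 1) div 3) = 1"
    and "e1 = (if [int q - 3 * int n = 1] (mod 9) then -2 else 1)"
    and "e2 = (if n mod 3 = 0 then -2 else 1)"
  shows "complex_of_nat (card {a::'a. bij (\<lambda>x::'a. x ^ n * (x ^ ((q - 1) div 3) + a))})
       = (2 * of_nat q - 3 * of_int (e1 + e2) - 10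
          - 2 * (pi_p p ^ k + cnj (pi_p p) ^ k)) / 9"
proof -
  interpret U: finite_subfield "UNIV :: 'a set" by (rule finite_subfield_UNIV)
  obtain w :: 'a where w: "cubic_subfield UNIV w"
    using U.cubic_subfield_ex assms(4,5) by blast
  interpret F: cubic_subfield "UNIV :: 'a set" w by (rule w)
  have s: "(q - 1) div 3 = F.s" by (simp add: F.s_def assms(4))
  have q: "q = 3 * F.s + 1" using F.card_K assms(4) by simp
  let ?N = "card {a::'a. bij (\<lambda>x::'a. x ^ n * (x ^ ((q - 1) div 3) + a))}"
  have bij: "bij f \<longleftrightarrow> inj f" for f :: "'a \<Rightarrow> 'a"
    by (metis bij_def finite_UNIV_inj_surj finite)
  have "coprime n F.s" using assms(7) unfolding s by (simp only: coprime_iff_gcd_eq_1)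
  hence "9 * int ?N = 2 * int q - 7 + 2 * F.trace
      - (if 3 dvd 2 * F.s + n then 0 else 9) + (if 3 dvd n then 9 else 0)"
    unfolding s bij using F.card_permuting[OF assms(6)] by (simp add: assms(4))
  \<comment> \<open>With \<open>q = 3 * s + 1\<close> the congruence says that 3 divides
    \<open>s - n\<close>, and \<open>(s - n) + (2 * s + n)\<close> is a multiple of 3.\<close>
  moreover have "[int q - 3 * int n = 1] (mod 9) \<longleftrightarrow> 3 dvd 2 * F.s + n"
  proof -
    have "[int q - 3 * int n = 1] (mod 9) \<longleftrightarrow> 9 dvd 3 * (int F.s - int n)"
      unfolding cong_iff_dvd_diff q by (simp add: algebra_simps)
    also have "\<dots> \<longleftrightarrow> 3 dvd int F.s - int n" by presburger
    also have "\<dots> \<longleftrightarrow> 3 dvd 2 * F.s + n" by presburger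
    finally show ?thesis .
  qed
  \<comment> \<open>The two corrections equal \<open>- 3 * e1 - 6\<close> and
    \<open>- 3 * e2 + 3\<close>, which turns -7 into -10.\<close>
  ultimately have "9 * int ?N = 2 * int q - 3 * (e1 + e2) - 10 + 2 * F.trace"
    unfolding assms(8,9) by (auto simp: dvd_eq_mod_eq_0)
  hence "complex_of_int (9 * int ?N) = of_int (2 * int q - 3 * (e1 + e2) - 10 + 2 * F.trace)"
    by (simp only:)
  hence "9 * complex_of_nat ?N = 2 * of_nat q - 3 * of_int (e1 + e2) - 10 + 2 * of_int F.trace"
    by simp
  moreover have "pi_p p ^ k + cnj (pi_p p) ^ k = - of_int F.trace"
    using pi_p_power_sum[OF assms(1,2) _ _ w] assms(3-5) by simp
  ultimately show ?thesis by (simp add: field_simps)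
qed

end
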